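(* A lopsp-operation $O$ is $\mathbf{c}2$ if and only if every 2-cycle in the predecoration $Q(O)$ has at least one of the vertices $v_0,v_1,v_2$ on each of its two sides.
   Context: A map is a connected multigraph (loops and parallel edges allowed) 2-cell embedded in a closed orientable surface; plane means embedded in the sphere. A lopsp-operation is a plane map $O$ with a colouring $c:V_O\to\{0,1,2\}$ and three marked vertices $v_0,v_1,v_2$ such that: (1) every face of $O$ is a triangle; (2) no edge joins two vertices of the same colour; (3) $c(v_0)\neq1$, $c(v_2)\neq1$, if $c(v_1)=1$ then $\deg(v_1)=2$, and every vertex $v\notin\{v_0,v_1,v_2\}$ with $c(v)=1$ has degree 4. An edge has colour $i$ if neither endpoint has colour $i$. The predecoration $Q(O)$ is the submap of $O$ consisting of all vertices of colours 0 and 2 and all edges of colour 1, together with, if $c(v_1)=1$, the vertex $v_1$ and the edge of colour 2 incident with $v_1$. A cut-path of $O$ is a path $P$ in $O$ from $v_1$ through $v_0$ to $v_2$. Cutting $O$ open along $P$ gives a plane map $O_P$ with one new face (the outer face) whose boundary consists of two copies of $P$. The lopsp-operation $O$ is $\mathbf{c}2$ if for every cut-path $P$ of minimal length (among all cut-paths), there is no 2-cycle in $O_P$. A 2-cycle is a cycle consisting of two parallel edges; in a plane map it separates the sphere into two sides. *)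

theory Defs
  imports
    "Graph_Theory.Graph_Theory"
    "HOL-Combinatorics.Orbits"
    "HOL-Combinatorics.Cycles"
begin

section \<open>Maps\<close>

text \<open>
  A multigraph that is 2-cell embedded in a closed oriented surface is encoded by its rotation
  system. Every edge consists of two darts (directed edges), which are exchanged by \<open>opp\<close>, and
  \<open>rot\<close> sends a dart to the next dart in the cyclic order around its tail. A vertex is
  represented by the set of all darts that leave it, that is, by an orbit of \<open>rot\<close>.
  The map that consists of a single vertex and no edge is not represented.
\<close>

record 'd cmap =
  darts :: "'d set"
  opp :: "'d \<Rightarrow> 'd"
  rot :: "'d \<Rightarrow> 'd"

definition vertex_of :: "('d, 'z) cmap_scheme \<Rightarrow> 'd \<Rightarrow> 'd set" where
  "vertex_of M d = orbit (rot M) d"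

text \<open>The underlying multigraph, as a symmetric digraph.\<close>

definition graph :: "('d, 'z) cmap_scheme \<Rightarrow> ('d set, 'd) pre_digraph" where
  "graph M = \<lparr>verts = vertex_of M ` darts M, arcs = darts M,
              tail = vertex_of M, head = (\<lambda>d. vertex_of M (opp M d))\<rparr>"

definition edges :: "('d, 'z) cmap_scheme \<Rightarrow> 'd set set" where
  "edges M = (\<lambda>d. {d, opp M d}) ` darts M"

text \<open>
  The dart that follows \<open>d\<close> in the facial walk through \<open>d\<close>; a face is the set of darts of its
  facial walk, so its cardinality is the length of that walk.
\<close>

definition face_next :: "('d, 'z) cmap_scheme \<Rightarrow> 'd \<Rightarrow> 'd" where
  "face_next M d = rot M (opp M d)"

definition faces :: "('d, 'z) cmap_scheme \<Rightarrow> 'd set set" where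
  "faces M = orbit (face_next M) ` darts M"

definition is_map :: "('d, 'z) cmap_scheme \<Rightarrow> bool" where
  "is_map M \<longleftrightarrow>
     finite (darts M) \<and> bidirected_digraph (graph M) (opp M) \<and>
     rot M permutes darts M \<and> connected (graph M)"

text \<open>The surface is the sphere if and only if the Euler characteristic is 2.\<close>

definition plane_map :: "('d, 'z) cmap_scheme \<Rightarrow> bool" where
  "plane_map M \<longleftrightarrow>
     is_map M \<and>
     int (card (verts (graph M))) - int (card (edges M)) + int (card (faces M)) = 2"


section \<open>Cycles of length two and their sides\<close>

text \<open>
  The set of the four darts of a 2-cycle of \<open>G\<close>, where \<open>r\<close> reverses darts. Since \<open>cycle\<close> counts
  \<open>[a, r a]\<close> as a cycle of a symmetric digraph, this case has to be excluded.
\<close>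

definition two_cycle :: "('v, 'd) pre_digraph \<Rightarrow> ('d \<Rightarrow> 'd) \<Rightarrow> 'd set \<Rightarrow> bool" where
  "two_cycle G r C \<longleftrightarrow>
     (\<exists>a b. pre_digraph.cycle G [a, b] \<and> b \<noteq> r a \<and> C = {a, r a, b, r b})"

text \<open>
  The components of the surface minus a cycle with dart set \<open>C\<close>. Each dart \<open>d\<close> stands for
  the face that contains \<open>d\<close>: one can move within a face, and across edges that are not in \<open>C\<close>.
  A component is represented by the darts of its faces.
\<close>

definition side_step :: "('d, 'z) cmap_scheme \<Rightarrow> 'd set \<Rightarrow> 'd rel" where
  "side_step M C =
     {(d, face_next M d) |d. d \<in> darts M} \<union> {(d, opp M d) |d. d \<in> darts M - C}"

definition sides :: "('d, 'z) cmap_scheme \<Rightarrow> 'd set \<Rightarrow> 'd set set" where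
  "sides M C = darts M // (side_step M C \<union> (side_step M C)\<inverse>)\<^sup>*"

text \<open>
  The vertex \<open>v\<close> lies in the component \<open>X\<close> of the complement of the cycle. Because a vertex is
  the set of its outgoing darts, the second conjunct says that \<open>v\<close> is not a vertex of the cycle.
\<close>

definition on_side :: "'d set \<Rightarrow> 'd set \<Rightarrow> 'd set \<Rightarrow> bool" where
  "on_side C X v \<longleftrightarrow> v \<subseteq> X \<and> v \<inter> C = {}"


section \<open>Lopsp-operations\<close>

record 'd lopsp = "'d cmap" +
  colour :: "'d set \<Rightarrow> nat"
  v0 :: "'d set"
  v1 :: "'d set"
  v2 :: "'d set"

definition lopsp_operation :: "'d lopsp \<Rightarrow> bool" where
  "lopsp_operation L \<longleftrightarrow>
     plane_map L \<and>
     colour L ` verts (graph L) \<subseteq> {0, 1, 2} \<and>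
     {v0 L, v1 L, v2 L} \<subseteq> verts (graph L) \<and> distinct [v0 L, v1 L, v2 L] \<and>
     (\<forall>F \<in> faces L. card F = 3) \<and>
     (\<forall>d \<in> darts L. colour L (tail (graph L) d) \<noteq> colour L (head (graph L) d)) \<and>
     colour L (v0 L) \<noteq> 1 \<and> colour L (v2 L) \<noteq> 1 \<and>
     (colour L (v1 L) = 1 \<longrightarrow> out_degree (graph L) (v1 L) = 2) \<and>
     (\<forall>v \<in> verts (graph L) - {v0 L, v1 L, v2 L}.
        colour L v = 1 \<longrightarrow> out_degree (graph L) v = 4)"

definition edge_has_colour :: "'d lopsp \<Rightarrow> nat \<Rightarrow> 'd \<Rightarrow> bool" where
  "edge_has_colour L i d \<longleftrightarrow>
     colour L (tail (graph L) d) \<noteq> i \<and> colour L (head (graph L) d) \<noteq> i"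

text \<open>
  The predecoration, as a subgraph of \<open>graph L\<close>. It is drawn in the same sphere as \<open>L\<close>, so
  the sides of its cycles are the sides in \<open>L\<close>.
\<close>

definition predecoration :: "'d lopsp \<Rightarrow> ('d set, 'd) pre_digraph" where
  "predecoration L = (graph L)
     \<lparr>verts := {v \<in> verts (graph L). colour L v \<in> {0, 2} \<or> colour L v = 1 \<and> v = v1 L},
      arcs := {d \<in> darts L. edge_has_colour L 1 d \<or>
                 colour L (v1 L) = 1 \<and> edge_has_colour L 2 d \<and>
                 v1 L \<in> {tail (graph L) d, head (graph L) d}}\<rparr>"


section \<open>Cut-paths and the property c2\<close>

definition cut_path :: "'d lopsp \<Rightarrow> 'd list \<Rightarrow> bool" where
  "cut_path L p \<longleftrightarrow>
     pre_digraph.apath (graph L) (v1 L) p (v2 L) \<and>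
     v0 L \<in> set (pre_digraph.awalk_verts (graph L) (v1 L) p)"

definition minimal_cut_path :: "'d lopsp \<Rightarrow> 'd list \<Rightarrow> bool" where
  "minimal_cut_path L p \<longleftrightarrow> cut_path L p \<and> (\<forall>q. cut_path L q \<longrightarrow> length p \<le> length q)"

text \<open>
  Cutting \<open>M\<close> open along the path \<open>p\<close>. Every edge of \<open>p\<close> is doubled: for each dart \<open>d\<close> of
  \<open>p\<close>, in either direction, the old dart \<open>Inl d\<close> keeps its place in its face and gets a new
  opposite dart \<open>Inr d\<close>, which runs from the head of \<open>d\<close> to its tail. The old faces are
  unchanged, and the new darts form the facial walk of the outer face: back along the one copy
  of \<open>p\<close> and then forth along the other. The rotation is recovered from
  \<open>face_next\<close> and \<open>opp\<close> as \<open>rot = face_next \<circ> opp\<close>.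
\<close>

definition path_darts :: "('d, 'z) cmap_scheme \<Rightarrow> 'd list \<Rightarrow> 'd set" where
  "path_darts M p = set p \<union> opp M ` set p"

definition cut_opp :: "('d, 'z) cmap_scheme \<Rightarrow> 'd list \<Rightarrow> 'd + 'd \<Rightarrow> 'd + 'd" where
  "cut_opp M p x =
     (case x of
        Inl d \<Rightarrow> if d \<in> path_darts M p then Inr d else Inl (opp M d)
      | Inr d \<Rightarrow> if d \<in> path_darts M p then Inl d else Inr d)"

definition cut_face_next :: "('d, 'z) cmap_scheme \<Rightarrow> 'd list \<Rightarrow> 'd + 'd \<Rightarrow> 'd + 'd" where
  "cut_face_next M p = map_sum (face_next M) (cycle_of_list (rev p @ map (opp M) p))"

definition cut_open :: "('d, 'z) cmap_scheme \<Rightarrow> 'd list \<Rightarrow> ('d + 'd) cmap" where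
  "cut_open M p =
     \<lparr>darts = darts M <+> path_darts M p,
      opp = cut_opp M p,
      rot = cut_face_next M p \<circ> cut_opp M p\<rparr>"

definition c2 :: "'d lopsp \<Rightarrow> bool" where
  "c2 L \<longleftrightarrow>
     (\<forall>p. minimal_cut_path L p \<longrightarrow>
        \<not> (\<exists>C. two_cycle (graph (cut_open L p)) (opp (cut_open L p)) C))"

end

theory Submission
  imports Defs
begin

text \<open>
  On the sphere every cycle modulo 2 bounds a set of faces. For a 2-cycle in the map cut open
  along a path this gives a side that avoids the outer face, hence a side in the original map that
  has no vertex of the path, and so no marked vertex, in its interior. If the 2-cycle passes
  through a vertex \<open>x\<close> of colour 1, which must have degree 4, its two edges are replaced
  by the edges opposite to \<open>x\<close> in the two triangles at \<open>x\<close> outside that side: this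
  adds only \<open>x\<close> to the interior and yields a 2-cycle of the predecoration.

  Conversely, given a 2-cycle with a side without marked vertices, a minimal cut-path with
  as few edges as possible inside that side has none there, because a detour through the side
  can be replaced by an edge of the 2-cycle. Hence the path does not cross the 2-cycle, which
  survives the cutting. A cut-path exists because a triangulation without loops is 2-connected.
\<close>

section \<open>Cycles modulo 2 on the sphere\<close>

text \<open>Separation by cycles is obtained by counting over GF(2) instead of topology.
  Connectedness bounds the dimension of the cycle space by E - V + 1, the coboundaries of sets of
  faces have dimension F - 1, and Euler's formula leaves no room between the two. The inequality V +
  F >= E + 2 suffices for this, so for the cut map one-sided bounds on the three numbers are enough.
  A side is never computed. A set of darts that is closed under \<open>face_next\<close>, and under
  \<open>opp\<close> off the cycle, contains every side that it meets, so a suitable closed set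
  controls the interior of a side. Two degenerate cases shape the argument. The two edges of a
  2-cycle in the cut map might be the two banks of a single path edge; this is excluded because a
  cut-path has at least two edges. The two triangle edges that replace a vertex of colour 1 might
  coincide; then the enlarged set would be the whole sphere, and three marked vertices would have to
  be among two vertices.\<close>

lemma orbit_eq_of_mem:
  assumes "f permutes S" "finite S" "y \<in> orbit f x"
  shows "orbit f y = orbit f x"
  using assms cyclic_on_orbit orbit_cyclic_eq3 by metis

lemma mem_orbit:
  assumes "f permutes S" "finite S"
  shows "x \<in> orbit f x"
  using assms permutation_permutes permutation_self_in_orbit by metis

lemma orbit_const:
  assumes "y \<in> orbit f x" "\<And>z. z \<in> orbit f x \<or> z = x \<Longrightarrow> g (f z) = g z"
  shows "g y = g x"
  using assms by (induction) auto

lemma odd_card_sym_diff: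
  assumes "finite A" "finite B"
  shows "odd (card (sym_diff A B)) \<longleftrightarrow> odd (card A) \<noteq> odd (card B)"
proof -
  have "card (sym_diff A B) = card (A - B) + card (B - A)"
    using assms by (intro card_Un_disjoint) auto
  moreover have "card A = card (A - B) + card (A \<inter> B)"
    using assms by (metis card_Diff_subset_Int card_mono finite_Int inf.cobounded1 le_add_diff_inverse2)
  moreover have "card B = card (B - A) + card (A \<inter> B)"
    using assms by (metis card_Diff_subset_Int card_mono finite_Int inf.cobounded1 inf_commute le_add_diff_inverse2)
  ultimately show ?thesis by presburger
qed

locale combinatorial_map =
  fixes M :: "('d, 'z) cmap_scheme"
  assumes finite_darts: "finite (darts M)"
    and opp_out: "d \<notin> darts M \<Longrightarrow> opp M d = d"
    and opp_opp [simp]: "opp M (opp M d) = d"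
    and opp_neq: "d \<in> darts M \<Longrightarrow> opp M d \<noteq> d"
    and rot_permutes: "rot M permutes darts M"
    and transitive: "\<lbrakk>S \<subseteq> darts M; S \<noteq> {}; \<And>d. d \<in> S \<Longrightarrow> opp M d \<in> S; \<And>d. d \<in> S \<Longrightarrow> rot M d \<in> S\<rbrakk>
      \<Longrightarrow> S = darts M"
begin

lemma rot_in: "rot M d \<in> darts M \<longleftrightarrow> d \<in> darts M"
  using rot_permutes by (simp add: permutes_in_image)

lemma mem_vertex_of [simp]: "d \<in> vertex_of M d"
  unfolding vertex_of_def using mem_orbit rot_permutes finite_darts by metis

lemma vertex_of_eq: "e \<in> vertex_of M d \<Longrightarrow> vertex_of M e = vertex_of M d"
  unfolding vertex_of_def using orbit_eq_of_mem rot_permutes finite_darts by metis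

lemma vertex_of_eq_iff: "vertex_of M e = vertex_of M d \<longleftrightarrow> e \<in> vertex_of M d"
  using vertex_of_eq mem_vertex_of by metis

lemma vertex_of_rot [simp]: "vertex_of M (rot M d) = vertex_of M d"
  by (rule vertex_of_eq) (simp add: vertex_of_def orbit.base)

lemma vertex_of_subset: "d \<in> darts M \<Longrightarrow> vertex_of M d \<subseteq> darts M"
  unfolding vertex_of_def using permutes_orbit_subset rot_permutes by metis

lemma face_next_opp [simp]: "face_next M (opp M d) = rot M d"
  by (simp add: face_next_def)

lemma opp_permutes: "opp M permutes darts M"
  unfolding permutes_def using opp_out opp_opp by metis

lemma opp_in_iff [simp]: "opp M d \<in> darts M \<longleftrightarrow> d \<in> darts M"
  using opp_permutes by (simp add: permutes_in_image)

lemma face_next_permutes: "face_next M permutes darts M"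
proof -
  have "face_next M = rot M \<circ> opp M" by (auto simp: face_next_def)
  then show ?thesis using permutes_compose[OF opp_permutes rot_permutes] by simp
qed

lemma face_next_in: "face_next M d \<in> darts M \<longleftrightarrow> d \<in> darts M"
  using face_next_permutes by (simp add: permutes_in_image)

lemma mem_face [simp]: "d \<in> orbit (face_next M) d"
  using mem_orbit face_next_permutes finite_darts by metis

lemma face_face_next [simp]:
  "orbit (face_next M) (face_next M d) = orbit (face_next M) d"
  using orbit_eq_of_mem[OF face_next_permutes finite_darts] orbit.base by metis

lemma transitive_face:
  assumes "S \<subseteq> darts M" "S \<noteq> {}" "\<And>d. d \<in> S \<Longrightarrow> opp M d \<in> S" "\<And>d. d \<in> S \<Longrightarrow> face_next M d \<in> S"
  shows "S = darts M"
proof (rule transitive[OF assms(1-3)])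
  fix d assume "d \<in> S"
  then show "rot M d \<in> S"
    using assms(3,4) face_next_opp by metis
qed

lemma card_darts: "card (darts M) = 2 * card (edges M)"
proof -
  have "card (\<Union> (edges M)) = (\<Sum>e\<in>edges M. card e)"
  proof (rule card_Union_disjoint)
    show "pairwise disjnt (edges M)"
      unfolding pairwise_def disjnt_def edges_def
      using opp_opp by (smt (verit, best) Int_emptyI imageE insert_commute insert_iff singletonD)
  qed (auto simp: edges_def)
  also have "\<dots> = (\<Sum>e\<in>edges M. 2)"
    using opp_neq by (intro sum.cong) (auto simp: edges_def card_2_iff)
  finally have "card (\<Union> (edges M)) = 2 * card (edges M)" by simp
  moreover have "\<Union> (edges M) = darts M"
    by (auto simp: edges_def)
  ultimately show ?thesis by simp
qed

section \<open>Edge space, cycle space and coboundaries over GF(2)\<close>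

definition edge_sets :: "'d set set" where
  "edge_sets = {S. S \<subseteq> darts M \<and> opp M ` S \<subseteq> S}"

definition vertices :: "'d set set" where
  "vertices = vertex_of M ` darts M"

text \<open>The cycle space over GF(2). Since an edge is represented by both of its darts,
  \<open>card (S \<inter> v)\<close> is the degree of \<open>v\<close> in \<open>S\<close>, with
  loops counted twice.\<close>

definition even_sets :: "'d set set" where
  "even_sets = {S \<in> edge_sets. \<forall>v\<in>vertices. even (card (S \<inter> v))}"

lemma finite_edge_sets: "finite edge_sets"
  unfolding edge_sets_def using finite_darts by (auto intro: finite_subset[OF _ finite_Pow_iff[THEN iffD2]])

lemma edge_sets_finite: "S \<in> edge_sets \<Longrightarrow> finite S"
  unfolding edge_sets_def using finite_darts finite_subset by blast

lemma edge_sets_opp_iff: "S \<in> edge_sets \<Longrightarrow> d \<in> darts M \<Longrightarrow> opp M d \<in> S \<longleftrightarrow> d \<in> S"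
  unfolding edge_sets_def using opp_opp by (metis (mono_tags, lifting) image_subset_iff mem_Collect_eq)

lemma card_edge_sets: "card edge_sets \<le> 2 ^ card (edges M)"
proof -
  have "inj_on (\<lambda>S. (\<lambda>d. {d, opp M d}) ` S) edge_sets"
  proof (rule inj_onI)
    fix S T assume S: "S \<in> edge_sets" and T: "T \<in> edge_sets"
      and eq: "(\<lambda>d. {d, opp M d}) ` S = (\<lambda>d. {d, opp M d}) ` T"
    have "S = \<Union> ((\<lambda>d. {d, opp M d}) ` S)" "T = \<Union> ((\<lambda>d. {d, opp M d}) ` T)"
      using S T unfolding edge_sets_def by auto
    then show "S = T" using eq by simp
  qed
  moreover have "(\<lambda>S. (\<lambda>d. {d, opp M d}) ` S) ` edge_sets \<subseteq> Pow (edges M)"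
    unfolding edge_sets_def edges_def by auto
  moreover have "finite (edges M)" using finite_darts by (simp add: edges_def)
  ultimately show ?thesis
    by (metis card_Pow card_inj_on_le finite_Pow_iff)
qed

lemma sym_diff_edge_sets:
  assumes "S \<in> edge_sets" "T \<in> edge_sets"
  shows "sym_diff S T \<in> edge_sets"
proof -
  have "sym_diff S T \<subseteq> darts M" using assms by (auto simp: edge_sets_def)
  then show ?thesis
    using edge_sets_opp_iff[OF assms(1)] edge_sets_opp_iff[OF assms(2)]
    by (auto simp: edge_sets_def subset_iff)
qed

lemma odd_sym_diff_inter:
  assumes "S \<in> edge_sets" "T \<in> edge_sets"
  shows "odd (card (sym_diff S T \<inter> v)) \<longleftrightarrow> odd (card (S \<inter> v)) \<noteq> odd (card (T \<inter> v))"
proof -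
  have "sym_diff S T \<inter> v = sym_diff (S \<inter> v) (T \<inter> v)" by blast
  then show ?thesis
    using odd_card_sym_diff[of "S \<inter> v" "T \<inter> v"] assms edge_sets_finite by simp
qed

lemma vertices_mem_iff: "v \<in> vertices \<Longrightarrow> d \<in> v \<longleftrightarrow> v = vertex_of M d"
  unfolding vertices_def using vertex_of_eq by auto

text \<open>The edges of a walk from \<open>r\<close> to \<open>d\<close>, added modulo 2, form such
  a set. In place of a walk, the proof uses transitivity: adding the edge of \<open>d\<close> moves
  the endpoint across it, and \<open>rot\<close> stays at the same vertex.\<close>

lemma odd_at_endpoints:
  assumes "d \<in> darts M" "r \<in> darts M"
  shows "\<exists>S\<in>edge_sets. \<forall>v\<in>vertices.
    odd (card (S \<inter> v)) \<longleftrightarrow> (v = vertex_of M d) \<noteq> (v = vertex_of M r)"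
proof -
  let ?P = "\<lambda>d S. \<forall>v\<in>vertices.
    odd (card (S \<inter> v)) \<longleftrightarrow> (v = vertex_of M d) \<noteq> (v = vertex_of M r)"
  have "{d \<in> darts M. \<exists>S\<in>edge_sets. ?P d S} = darts M"
  proof (rule transitive)
    have "{} \<in> edge_sets" by (simp add: edge_sets_def)
    then have "\<exists>S\<in>edge_sets. ?P r S" by (intro bexI[of _ "{}"]) auto
    then show "{d \<in> darts M. \<exists>S\<in>edge_sets. ?P d S} \<noteq> {}" using assms(2) by blast
  next
    fix d assume "d \<in> {d \<in> darts M. \<exists>S\<in>edge_sets. ?P d S}"
    then obtain S where d: "d \<in> darts M" and S: "S \<in> edge_sets" "?P d S" by blast
    let ?e = "{d, opp M d}"
    have e: "?e \<in> edge_sets"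
      using d by (auto simp: edge_sets_def)
    have *: "odd (card (?e \<inter> v)) \<longleftrightarrow> (v = vertex_of M d) \<noteq> (v = vertex_of M (opp M d))"
      if "v \<in> vertices" for v
      using opp_neq[OF d] unfolding vertices_mem_iff[OF that, symmetric]
      by (cases "d \<in> v"; cases "opp M d \<in> v") auto
    have "?P (opp M d) (sym_diff S ?e)"
    proof
      fix v assume v: "v \<in> vertices"
      show "odd (card (sym_diff S ?e \<inter> v)) \<longleftrightarrow> (v = vertex_of M (opp M d)) \<noteq> (v = vertex_of M r)"
        using odd_sym_diff_inter[OF S(1) e, of v] *[OF v] S(2)[rule_format, OF v] by argo
    qed
    moreover have "opp M d \<in> darts M" using d by simp
    ultimately show "opp M d \<in> {d \<in> darts M. \<exists>S\<in>edge_sets. ?P d S}"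
      using sym_diff_edge_sets[OF S(1) e] by blast
  next
    fix d assume "d \<in> {d \<in> darts M. \<exists>S\<in>edge_sets. ?P d S}"
    then show "rot M d \<in> {d \<in> darts M. \<exists>S\<in>edge_sets. ?P d S}" by (simp add: rot_in)
  qed auto
  then show ?thesis using assms(1) by blast
qed

text \<open>Add the sets from \<open>odd_at_endpoints\<close> that join the vertices of
  \<open>w\<close> to the root \<open>r\<close>. The parity at \<open>r\<close> is left open because
  the number of odd vertices is always even.\<close>

lemma odd_at_vertex_set:
  assumes r: "r \<in> vertices" and w: "w \<subseteq> vertices - {r}"
  shows "\<exists>S\<in>edge_sets. \<forall>v\<in>vertices - {r}. odd (card (S \<inter> v)) \<longleftrightarrow> v \<in> w"
proof -
  have "finite w" using w finite_darts finite_subset unfolding vertices_def by blast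
  then show ?thesis using w
  proof (induction w)
    case empty
    have "{} \<in> edge_sets" by (simp add: edge_sets_def)
    then show ?case by (intro bexI[of _ "{}"]) auto
  next
    case (insert x w)
    then obtain S where S: "S \<in> edge_sets"
      and Sw: "\<forall>v\<in>vertices - {r}. odd (card (S \<inter> v)) \<longleftrightarrow> v \<in> w" by auto
    obtain d e where "d \<in> darts M" "x = vertex_of M d" "e \<in> darts M" "r = vertex_of M e"
      using r insert.prems by (auto simp: vertices_def)
    then obtain T where T: "T \<in> edge_sets"
      and Tx: "\<forall>v\<in>vertices. odd (card (T \<inter> v)) \<longleftrightarrow> (v = x) \<noteq> (v = r)"
      using odd_at_endpoints by metis
    have "\<forall>v\<in>vertices - {r}. odd (card (sym_diff S T \<inter> v)) \<longleftrightarrow> v \<in> insert x w"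
      using odd_sym_diff_inter[OF S T] Sw Tx insert.hyps by auto
    then show ?case using sym_diff_edge_sets[OF S T] by blast
  qed
qed

text \<open>The dimension of the cycle space is at most E - V + 1: the sets \<open>s w\<close>
  represent 2^(V - 1) different cosets of \<open>even_sets\<close> in the edge space, because the
  parities away from \<open>r\<close> recover \<open>w\<close>.\<close>

lemma card_even_sets:
  assumes "darts M \<noteq> {}"
  shows "card even_sets * 2 ^ (card vertices - 1) \<le> 2 ^ card (edges M)"
proof -
  obtain r where r: "r \<in> vertices" using assms by (auto simp: vertices_def)
  have "\<forall>w\<in>Pow (vertices - {r}). \<exists>S\<in>edge_sets.
      \<forall>v\<in>vertices - {r}. odd (card (S \<inter> v)) \<longleftrightarrow> v \<in> w"
    using odd_at_vertex_set[OF r] by blast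
  then obtain s where s: "\<And>w. w \<subseteq> vertices - {r} \<Longrightarrow> s w \<in> edge_sets"
      "\<And>w v. w \<subseteq> vertices - {r} \<Longrightarrow> v \<in> vertices - {r} \<Longrightarrow> odd (card (s w \<inter> v)) \<longleftrightarrow> v \<in> w"
    by (metis Pow_iff)
  let ?g = "\<lambda>(z, w). sym_diff z (s w)"
  have "inj_on ?g (even_sets \<times> Pow (vertices - {r}))"
  proof (rule inj_onI, clarify)
    fix z w z' w' assume z: "z \<in> even_sets" and z': "z' \<in> even_sets"
      and w: "w \<subseteq> vertices - {r}" and w': "w' \<subseteq> vertices - {r}"
      and eq: "sym_diff z (s w) = sym_diff z' (s w')"
    have zs: "z \<in> edge_sets" "z' \<in> edge_sets" using z z' by (auto simp: even_sets_def)
    have "v \<in> w \<longleftrightarrow> v \<in> w'" if v: "v \<in> vertices - {r}" for v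
    proof -
      have "odd (card (sym_diff z (s w) \<inter> v)) \<longleftrightarrow> v \<in> w"
        using odd_sym_diff_inter[OF zs(1) s(1)[OF w], of v] s(2)[OF w v] z v
        by (auto simp: even_sets_def)
      moreover have "odd (card (sym_diff z' (s w') \<inter> v)) \<longleftrightarrow> v \<in> w'"
        using odd_sym_diff_inter[OF zs(2) s(1)[OF w'], of v] s(2)[OF w' v] z' v
        by (auto simp: even_sets_def)
      ultimately show ?thesis using eq by simp
    qed
    then have "w = w'" using w w' by blast
    moreover from this have "z = z'" using eq by blast
    ultimately show "z = z' \<and> w = w'" by simp
  qed
  moreover have "?g ` (even_sets \<times> Pow (vertices - {r})) \<subseteq> edge_sets"
    using s(1) sym_diff_edge_sets by (auto simp: even_sets_def image_subset_iff)
  ultimately have "card (even_sets \<times> Pow (vertices - {r})) \<le> card edge_sets"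
    using card_inj_on_le finite_edge_sets by blast
  moreover have "card (Pow (vertices - {r})) = 2 ^ (card vertices - 1)"
    using r finite_darts by (simp add: card_Pow vertices_def)
  ultimately show ?thesis
    using card_edge_sets by (simp add: card_cartesian_product)
qed

text \<open>The boundary of a union of faces; equivalently, the cut in the dual graph that
  \<open>G\<close> determines.\<close>

definition coboundary :: "'d set set \<Rightarrow> 'd set" where
  "coboundary G = {d \<in> darts M. (orbit (face_next M) d \<in> G) \<noteq> (orbit (face_next M) (opp M d) \<in> G)}"

text \<open>The darts \<open>opp M e\<close> and \<open>rot M e\<close> lie in the same face. Hence
  the edges of the coboundary at a vertex mark the changes of membership in \<open>G\<close> between
  cyclically consecutive darts, and the number of changes around a cyclic order is even.\<close>

lemma coboundary_even: "coboundary G \<in> even_sets"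
proof -
  let ?f = "\<lambda>d. orbit (face_next M) d \<in> G"
  have "coboundary G \<in> edge_sets"
    by (auto simp: coboundary_def edge_sets_def)
  moreover have "even (card (coboundary G \<inter> v))" if v: "v \<in> vertices" for v
  proof -
    obtain d where d: "d \<in> darts M" "v = vertex_of M d" using v by (auto simp: vertices_def)
    have sub: "v \<subseteq> darts M" using d vertex_of_subset by simp
    have fin: "finite v" using sub finite_darts finite_subset by blast
    have f_opp: "?f (opp M e) = ?f (rot M e)" if "e \<in> darts M" for e
      using face_face_next[of "opp M e"] by simp
    define A where "A = {e \<in> v. ?f e}"
    define B where "B = {e \<in> v. ?f (rot M e)}"
    have inj: "inj (rot M)" using rot_permutes permutes_inj by blast
    have in_v: "rot M e \<in> v" if "e \<in> v" for e
      using that d(2) vertex_of_eq vertex_of_rot mem_vertex_of by metis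
    then have "rot M ` v = v"
      using fin inj by (metis endo_inj_surj image_subsetI inj_on_subset subset_UNIV)
    moreover have "rot M ` B = {e \<in> rot M ` v. ?f e}" unfolding B_def by auto
    ultimately have "rot M ` B = A" by (simp add: A_def)
    then have "card A = card B" using inj by (metis card_image inj_on_subset subset_UNIV)
    moreover have "coboundary G \<inter> v = sym_diff A B"
      using sub f_opp by (auto simp: coboundary_def A_def B_def)
    ultimately show ?thesis
      using odd_card_sym_diff[of A B] fin by (simp add: A_def B_def)
  qed
  ultimately show ?thesis by (simp add: even_sets_def)
qed

text \<open>If the coboundaries are equal, then agreement of \<open>G\<close> and \<open>H\<close>
  on a face passes to the face across any edge. It holds at \<open>f0\<close>, which lies in
  neither, and spreads over the connected map.\<close>

lemma coboundary_inj:
  assumes f0: "f0 \<in> faces M"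
  shows "inj_on coboundary (Pow (faces M - {f0}))"
proof (rule inj_onI)
  fix G H assume G: "G \<in> Pow (faces M - {f0})" and H: "H \<in> Pow (faces M - {f0})"
    and eq: "coboundary G = coboundary H"
  let ?f = "\<lambda>d. orbit (face_next M) d"
  obtain e where e: "e \<in> darts M" "f0 = ?f e" using f0 by (auto simp: faces_def)
  have "{d \<in> darts M. ?f d \<in> G \<longleftrightarrow> ?f d \<in> H} = darts M"
  proof (rule transitive_face)
    show "{d \<in> darts M. ?f d \<in> G \<longleftrightarrow> ?f d \<in> H} \<noteq> {}" using e G H by blast
  next
    fix d assume d: "d \<in> {d \<in> darts M. ?f d \<in> G \<longleftrightarrow> ?f d \<in> H}"
    then have "d \<in> coboundary G \<longleftrightarrow> d \<in> coboundary H" using eq by simp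
    then show "opp M d \<in> {d \<in> darts M. ?f d \<in> G \<longleftrightarrow> ?f d \<in> H}"
      using d by (auto simp: coboundary_def)
  next
    fix d assume "d \<in> {d \<in> darts M. ?f d \<in> G \<longleftrightarrow> ?f d \<in> H}"
    then show "face_next M d \<in> {d \<in> darts M. ?f d \<in> G \<longleftrightarrow> ?f d \<in> H}"
      using face_next_in by simp
  qed auto
  then show "G = H" using G H by (auto simp: faces_def)
qed

text \<open>Coboundaries of sets of faces are even, and by Euler's formula there are at least as many
  of them as even sets.\<close>

theorem even_set_separates:
  assumes euler: "card vertices + card (faces M) \<ge> card (edges M) + 2"
    and C: "C \<in> even_sets"
  shows "\<exists>f. (\<forall>d\<in>darts M. f (face_next M d) = f d) \<and>
             (\<forall>d\<in>darts M. f (opp M d) \<noteq> (f d :: bool) \<longleftrightarrow> d \<in> C)"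
proof (cases "darts M = {}")
  case False
  then obtain f0 where f0: "f0 \<in> faces M" by (auto simp: faces_def)
  have pos: "card vertices > 0" "card (faces M) > 0"
    using False finite_darts by (auto simp: vertices_def faces_def card_gt_0_iff)
  have fin: "finite even_sets" using finite_edge_sets by (simp add: even_sets_def)
  have "card even_sets * 2 ^ (card vertices - 1) \<le> 2 ^ card (edges M)"
    by (rule card_even_sets[OF False])
  also have "\<dots> \<le> (2::nat) ^ (card (faces M) - 1 + (card vertices - 1))"
    using euler pos by (intro power_increasing) auto
  finally have "card even_sets \<le> 2 ^ (card (faces M) - 1)"
    by (simp add: power_add)
  moreover have "card (coboundary ` Pow (faces M - {f0})) = 2 ^ (card (faces M) - 1)"
    using card_image[OF coboundary_inj[OF f0]] f0 finite_darts
    by (simp add: card_Pow faces_def)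
  moreover have "coboundary ` Pow (faces M - {f0}) \<subseteq> even_sets"
    using coboundary_even by blast
  ultimately have "coboundary ` Pow (faces M - {f0}) = even_sets"
    using card_seteq fin by metis
  then obtain G where G: "C = coboundary G" using C by blast
  show ?thesis
    by (rule exI[of _ "\<lambda>d. orbit (face_next M) d \<in> G"]) (auto simp: G coboundary_def)
qed auto

section \<open>2-cycles as pairs of parallel darts\<close>

definition parallel :: "'d \<Rightarrow> 'd \<Rightarrow> bool" where
  "parallel a b \<longleftrightarrow> a \<in> darts M \<and> b \<in> darts M \<and> a \<noteq> b \<and>
     vertex_of M a = vertex_of M b \<and> vertex_of M (opp M a) = vertex_of M (opp M b) \<and>
     vertex_of M a \<noteq> vertex_of M (opp M a)"

definition edge_pair :: "'d \<Rightarrow> 'd \<Rightarrow> 'd set" where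
  "edge_pair a b = {a, opp M a, b, opp M b}"

text \<open>\<open>cycle\<close> traverses the second edge backwards, whereas
  \<open>parallel\<close> directs both darts from the same tail to the same head; hence the
  \<open>opp M b\<close> in the translation.\<close>

lemma two_cycle_iff:
  "two_cycle (graph M) (opp M) C \<longleftrightarrow> (\<exists>a b. parallel a b \<and> C = edge_pair a b)"
proof -
  have *: "pre_digraph.cycle (graph M) [a, b] \<and> b \<noteq> opp M a \<longleftrightarrow> parallel a (opp M b)" for a b
    unfolding pre_digraph.cycle_def pre_digraph.awalk_def parallel_def
    by (auto simp: graph_def pre_digraph.awalk_verts.simps pre_digraph.cas.simps)
  show ?thesis
    unfolding two_cycle_def edge_pair_def
  proof safe
    fix a b assume "pre_digraph.cycle (graph M) [a, b]" "b \<noteq> opp M a"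
    then have "parallel a (opp M b)" using * by blast
    then show "\<exists>a' b'. parallel a' b' \<and> {a, opp M a, b, opp M b} = {a', opp M a', b', opp M b'}"
      by (intro exI[of _ a] exI[of _ "opp M b"]) auto
  next
    fix a b assume "parallel a b"
    then show "\<exists>a' b'. pre_digraph.cycle (graph M) [a', b'] \<and> b' \<noteq> opp M a' \<and>
        {a, opp M a, b, opp M b} = {a', opp M a', b', opp M b'}"
      using *[of a "opp M b"] by (intro exI[of _ a] exI[of _ "opp M b"]) auto
  qed
qed

lemma parallel_sym: "parallel a b \<Longrightarrow> parallel b a"
  by (auto simp: parallel_def)

lemma parallel_opp: "parallel a b \<Longrightarrow> parallel (opp M a) (opp M b)"
  by (auto simp: parallel_def) (metis opp_opp)+

lemma edge_pair_sym: "edge_pair a b = edge_pair b a"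
  by (auto simp: edge_pair_def)

lemma edge_pair_opp: "edge_pair (opp M a) (opp M b) = edge_pair a b"
  by (auto simp: edge_pair_def)

lemma edge_pair_even:
  assumes "parallel a b"
  shows "edge_pair a b \<in> even_sets"
proof -
  have ab: "a \<in> darts M" "b \<in> darts M" "a \<noteq> b" "opp M a \<noteq> opp M b"
      "vertex_of M b = vertex_of M a" "vertex_of M (opp M b) = vertex_of M (opp M a)"
      "vertex_of M (opp M a) \<noteq> vertex_of M a"
    using assms unfolding parallel_def by (auto dest: arg_cong[of _ _ "opp M"])
  have "even (card (edge_pair a b \<inter> v))" if "v \<in> vertices" for v
  proof -
    have "b \<in> v \<longleftrightarrow> a \<in> v" "opp M b \<in> v \<longleftrightarrow> opp M a \<in> v" "\<not> (a \<in> v \<and> opp M a \<in> v)"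
      unfolding vertices_mem_iff[OF that] using ab by auto
    then have "edge_pair a b \<inter> v =
        (if a \<in> v then {a, b} else if opp M a \<in> v then {opp M a, opp M b} else {})"
      by (auto simp: edge_pair_def)
    then show ?thesis using ab by simp
  qed
  then show ?thesis
    using ab by (auto simp: even_sets_def edge_sets_def edge_pair_def)
qed

end

section \<open>Cutting open along a path\<close>

text \<open>Used to run through the darts of an angle at a vertex. With the least positive
  \<open>m\<close> that reaches \<open>b\<close>, no earlier return to \<open>a\<close> is possible,
  since \<open>b\<close> would then be reached sooner.\<close>

lemma permutation_sector:
  assumes "b \<in> orbit f a"
  obtains m where "0 < m" "(f ^^ m) a = b" "\<And>k. 0 < k \<Longrightarrow> k < m \<Longrightarrow> (f ^^ k) a \<notin> {a, b}"
proof -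
  let ?Q = "\<lambda>m. 0 < m \<and> (f ^^ m) a = b"
  define m where "m = (LEAST m. ?Q m)"
  have "\<exists>m. ?Q m" using assms by (auto simp: orbit_altdef)
  then have m: "?Q m" unfolding m_def by (rule LeastI_ex)
  have least: "\<not> ?Q k" if "k < m" for k using that not_less_Least unfolding m_def by blast
  have "(f ^^ k) a \<noteq> a" if "0 < k" "k < m" for k
  proof
    assume "(f ^^ k) a = a"
    moreover have "(f ^^ m) a = (f ^^ (m - k)) ((f ^^ k) a)"
      using that by (metis add_diff_inverse_nat add.commute comp_apply funpow_add less_imp_not_less)
    ultimately have "?Q (m - k)" using m that by simp
    then show False using least[of "m - k"] that by simp
  qed
  then show ?thesis using that[of m] m least by blast
qed

lemma orbit_closed_subset:
  assumes "x \<in> S" "\<And>y. y \<in> S \<Longrightarrow> f y \<in> S"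
  shows "orbit f x \<subseteq> S"
proof
  fix y assume "y \<in> orbit f x"
  then show "y \<in> S" by induction (auto intro: assms)
qed

lemma cycle_of_list_nth:
  assumes "distinct cs" "k < length cs"
  shows "cycle_of_list cs (cs ! k) = cs ! (Suc k mod length cs)"
proof -
  have "map (cycle_of_list cs) cs = rotate1 cs"
    using cyclic_rotation[OF assms(1), of 1] by simp
  then have "map (cycle_of_list cs) cs ! k = rotate1 cs ! k" by simp
  then show ?thesis using assms(2) by (simp add: nth_rotate1)
qed

text \<open>\<open>path_inj\<close> speaks of tails only; \<open>path_end\<close> adds that the last
  vertex of the path, which occurs as a head, is new.\<close>

locale cut_map = combinatorial_map M for M :: "('d, 'z) cmap_scheme" +
  fixes p :: "'d list"
  assumes path_subset: "set p \<subseteq> darts M"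
    and path_nonempty: "p \<noteq> []"
    and path_step: "Suc i < length p \<Longrightarrow> vertex_of M (opp M (p ! i)) = vertex_of M (p ! Suc i)"
    and path_inj: "\<lbrakk>i < length p; j < length p; vertex_of M (p ! i) = vertex_of M (p ! j)\<rbrakk> \<Longrightarrow> i = j"
    and path_end: "i < length p \<Longrightarrow> vertex_of M (opp M (p ! (length p - 1))) \<noteq> vertex_of M (p ! i)"
begin

abbreviation "n \<equiv> length p"
abbreviation "P \<equiv> path_darts M p"
abbreviation "K \<equiv> cut_open M p"
abbreviation "outer_next \<equiv> cycle_of_list (rev p @ map (opp M) p)"

lemma path_in: "i < n \<Longrightarrow> p ! i \<in> darts M"
  using path_subset nth_mem by blast

lemma P_subset: "P \<subseteq> darts M"
  using path_subset by (auto simp: path_darts_def)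

lemma finite_P: "finite P"
  by (simp add: path_darts_def)

lemma opp_P [simp]: "opp M d \<in> P \<longleftrightarrow> d \<in> P"
  unfolding path_darts_def by auto (metis image_eqI opp_opp)+

lemma P_cases:
  assumes "d \<in> P"
  obtains i where "i < n" "d = p ! i" | i where "i < n" "d = opp M (p ! i)"
  using assms unfolding path_darts_def by (auto simp: in_set_conv_nth)

lemma nth_in_P: "i < n \<Longrightarrow> p ! i \<in> P"
  by (simp add: path_darts_def)

lemma distinct_path: "distinct p"
  unfolding distinct_conv_nth using path_inj by metis

text \<open>An edge traversed in both directions would make \<open>j\<close> the successor of
  \<open>i\<close> and, symmetrically, \<open>i\<close> the successor of \<open>j\<close>.\<close>

lemma opp_nth_neq:
  assumes "i < n" "j < n"
  shows "opp M (p ! i) \<noteq> p ! j"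
proof
  assume eq: "opp M (p ! i) = p ! j"
  then have eq': "opp M (p ! j) = p ! i" by (metis opp_opp)
  have succ: "b = Suc a" if "a < n" "b < n" "opp M (p ! a) = p ! b" for a b
  proof (cases "Suc a < n")
    case True
    then show ?thesis using path_step[of a] path_inj[of "Suc a" b] that by metis
  next
    case False
    then have "a = n - 1" using that by simp
    then show ?thesis using path_end[of b] that by metis
  qed
  show False using succ[OF assms eq] succ[OF assms(2,1) eq'] by simp
qed

lemma distinct_outer: "distinct (rev p @ map (opp M) p)"
proof -
  have "distinct (map (opp M) p)"
    using distinct_path by (metis distinct_map inj_onI opp_opp)
  moreover have "set p \<inter> opp M ` set p = {}"
    using opp_nth_neq by (fastforce simp: in_set_conv_nth)
  ultimately show ?thesis using distinct_path by auto
qed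

lemma outer_nth:
  assumes "k < 2 * n"
  shows "(rev p @ map (opp M) p) ! k = (if k < n then p ! (n - Suc k) else opp M (p ! (k - n)))"
  using assms by (auto simp: nth_append rev_nth)

text \<open>Positions below \<open>n\<close> run along \<open>p\<close> from its end to its start,
  the others run forward again. At both ends of the path the walk turns around on the same
  edge.\<close>

lemma outer_next_nth:
  assumes "k < 2 * n"
  shows "outer_next (if k < n then p ! (n - Suc k) else opp M (p ! (k - n))) =
    (if Suc k < n then p ! (n - Suc (Suc k)) else if Suc k < 2 * n then opp M (p ! (Suc k - n))
     else p ! (n - 1))"
proof -
  have "outer_next ((rev p @ map (opp M) p) ! k) = (rev p @ map (opp M) p) ! (Suc k mod (2 * n))"
    using cycle_of_list_nth[OF distinct_outer, of k] assms by (simp add: mult_2)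
  also have "Suc k mod (2 * n) = (if Suc k < 2 * n then Suc k else 0)"
    using assms by (auto simp: mod_if)
  finally show ?thesis
    using outer_nth[of k] outer_nth[of "Suc k"] outer_nth[of 0] assms path_nonempty
    by (auto split: if_splits)
qed

lemma outer_next_Suc:
  assumes "Suc i < n"
  shows "outer_next (p ! Suc i) = p ! i"
proof -
  have "n - Suc (n - Suc (Suc i)) = Suc i" "n - Suc (Suc (n - Suc (Suc i))) = i"
    "n - Suc (Suc i) < 2 * n" "Suc (n - Suc (Suc i)) < n"
    using assms by auto
  then show ?thesis using outer_next_nth[of "n - Suc (Suc i)"] by simp
qed

lemma outer_next_0: "outer_next (p ! 0) = opp M (p ! 0)"
proof -
  have "n \<noteq> 0" using path_nonempty by simp
  then have "n - 1 < 2 * n" "n - 1 < n" "n - Suc (n - 1) = 0" "\<not> Suc (n - 1) < n"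
    "Suc (n - 1) < 2 * n" "Suc (n - 1) - n = 0" by linarith+
  then show ?thesis using outer_next_nth[of "n - 1"] by simp
qed

lemma outer_next_opp: "Suc i < n \<Longrightarrow> outer_next (opp M (p ! i)) = opp M (p ! Suc i)"
  using outer_next_nth[of "n + i"] by simp

lemma outer_next_last: "outer_next (opp M (p ! (n - 1))) = p ! (n - 1)"
proof -
  have "n \<noteq> 0" using path_nonempty by simp
  then have "n + n - 1 < 2 * n" "\<not> n + n - 1 < n" "n + n - 1 - n = n - 1"
    "\<not> Suc (n + n - 1) < n" "\<not> Suc (n + n - 1) < 2 * n" by linarith+
  then show ?thesis using outer_next_nth[of "n + n - 1"] by simp
qed

lemma outer_next_permutes: "outer_next permutes P"
proof -
  have "P = set (rev p @ map (opp M) p)" by (auto simp: path_darts_def)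
  then show ?thesis using cycle_permutes[of "rev p @ map (opp M) p"] by simp
qed

text \<open>\<open>Inr d\<close> ends at the tail of \<open>d\<close>, and \<open>Inr e\<close>
  starts at the head of \<open>e\<close>; so the outer facial walk is continuous when seen in the
  original map.\<close>

lemma vertex_outer_next:
  assumes "d \<in> P"
  shows "vertex_of M (opp M (outer_next d)) = vertex_of M d"
proof (cases rule: P_cases[OF assms])
  case (1 i)
  then show ?thesis
    using outer_next_0 outer_next_Suc path_step by (cases i) auto
next
  case (2 i)
  show ?thesis
  proof (cases "Suc i < n")
    case True
    then show ?thesis using 2 outer_next_opp path_step by simp
  next
    case False
    then have "i = n - 1" using 2 by simp
    then show ?thesis using 2 outer_next_last by simp
  qed
qed

section \<open>The cut map as a connected map, and its gluing map\<close>

lemma darts_K: "darts K = darts M <+> P"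
  by (simp add: cut_open_def)

lemma opp_K [simp]:
  "opp K (Inl d) = (if d \<in> P then Inr d else Inl (opp M d))"
  "opp K (Inr d) = (if d \<in> P then Inl d else Inr d)"
  by (simp_all add: cut_open_def cut_opp_def)

lemma opp_opp_K [simp]: "opp K (opp K x) = x"
  by (cases x) auto

lemma rot_K: "rot K x = cut_face_next M p (opp K x)"
  by (simp add: cut_open_def)

lemma face_next_K [simp]:
  "face_next K (Inl d) = Inl (face_next M d)"
  "face_next K (Inr d) = Inr (outer_next d)"
  by (simp_all only: face_next_def[of K] rot_K opp_opp_K) (simp_all add: cut_face_next_def)

lemma rot_K_eq: "rot K x = face_next K (opp K x)"
  by (simp add: face_next_def)

lemma face_next_K_permutes: "face_next K permutes darts K"
proof (rule bij_imp_permutes)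
  have inj: "inj_on (face_next K) (darts K)"
  proof (rule inj_onI)
    fix x y assume "face_next K x = face_next K y"
    then show "x = y"
      using permutes_inj[OF face_next_permutes] permutes_inj[OF outer_next_permutes]
      by (cases x; cases y) (auto dest: injD)
  qed
  have "face_next K ` darts K \<subseteq> darts K"
    using face_next_in permutes_in_image[OF outer_next_permutes] by (auto simp: darts_K)
  then show "bij_betw (face_next K) (darts K) (darts K)"
    using inj finite_darts finite_P by (metis bij_betw_def darts_K endo_inj_surj finite_Plus)
  show "face_next K x = x" if "x \<notin> darts K" for x
    using that permutes_not_in[OF face_next_permutes] permutes_not_in[OF outer_next_permutes]
    by (cases x) (auto simp: darts_K)
qed

lemma opp_K_permutes: "opp K permutes darts K"
proof -
  have "opp K x = x" if "x \<notin> darts K" for x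
    using that P_subset opp_out by (cases x) (auto simp: darts_K)
  then show ?thesis unfolding permutes_def by (metis opp_opp_K)
qed

sublocale cut: combinatorial_map K
proof
  show "finite (darts K)" using finite_darts finite_P by (simp add: darts_K)
  show "opp K x = x" if "x \<notin> darts K" for x
    using that opp_K_permutes permutes_not_in by metis
  show "opp K x \<noteq> x" if "x \<in> darts K" for x
    using that opp_neq by (cases x) (auto simp: darts_K)
  have "rot K = face_next K \<circ> opp K" by (auto simp: rot_K_eq)
  then show "rot K permutes darts K"
    using permutes_compose[OF opp_K_permutes face_next_K_permutes] by simp
  fix S assume S: "S \<subseteq> darts K" "S \<noteq> {}" "\<And>x. x \<in> S \<Longrightarrow> opp K x \<in> S" "\<And>x. x \<in> S \<Longrightarrow> rot K x \<in> S"
  have fn: "face_next K x \<in> S" if "x \<in> S" for x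
    using S(3,4) that unfolding face_next_def by blast
  \<comment> \<open>The two banks of a path edge get connected around the outer face: from
    \<open>Inl d\<close> to \<open>Inr d\<close>, along the outer walk to
    \<open>Inr (opp M d)\<close>, and from there to \<open>Inl (opp M d)\<close>.\<close>
  have outer_back: "Inr d \<in> S \<Longrightarrow> d \<in> P \<Longrightarrow> Inr (opp M d) \<in> S" for d
  proof -
    assume d: "Inr d \<in> S" "d \<in> P"
    have down: "Inr (p ! i) \<in> S \<Longrightarrow> i < n \<Longrightarrow> Inr (p ! 0) \<in> S" for i
    proof (induction i)
      case (Suc i)
      then show ?case using fn[of "Inr (p ! Suc i)"] outer_next_Suc by simp
    qed
    have up: "Inr (opp M (p ! 0)) \<in> S \<Longrightarrow> i < n \<Longrightarrow> Inr (opp M (p ! i)) \<in> S" for i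
    proof (induction i)
      case (Suc i)
      then show ?case using fn[of "Inr (opp M (p ! i))"] outer_next_opp by simp
    qed
    have up': "Inr (opp M (p ! i)) \<in> S \<Longrightarrow> i < n \<Longrightarrow> Inr (p ! (n - 1)) \<in> S" for i
    proof (induction "n - i" arbitrary: i)
      case (Suc k)
      show ?case
      proof (cases "Suc i < n")
        case True
        then show ?thesis
          using Suc fn[of "Inr (opp M (p ! i))"] outer_next_opp by (metis Suc_diff_Suc diff_Suc_Suc face_next_K(2) nat.inject)
      next
        case False
        then have "i = n - 1" using Suc by simp
        then show ?thesis using Suc fn[of "Inr (opp M (p ! i))"] outer_next_last by simp
      qed
    qed simp
    have down': "Inr (p ! (n - 1)) \<in> S \<Longrightarrow> i < n \<Longrightarrow> Inr (p ! i) \<in> S" for i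
    proof (induction "n - i" arbitrary: i)
      case (Suc k)
      show ?case
      proof (cases "Suc i < n")
        case True
        then have "Inr (p ! Suc i) \<in> S" using Suc by simp
        then show ?thesis using True fn[of "Inr (p ! Suc i)"] outer_next_Suc by simp
      next
        case False
        then have "i = n - 1" using Suc by simp
        then show ?thesis using Suc by simp
      qed
    qed simp
    show "Inr (opp M d) \<in> S"
    proof (cases rule: P_cases[OF d(2)])
      case (1 i)
      then have "Inr (p ! 0) \<in> S" using down d by simp
      then have "Inr (opp M (p ! 0)) \<in> S" using fn[of "Inr (p ! 0)"] outer_next_0 by simp
      then show ?thesis using up 1 by simp
    next
      case (2 i)
      then show ?thesis using up' down' d by simp
    qed
  qed
  let ?T = "{d \<in> darts M. Inl d \<in> S}"
  have "?T = darts M"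
  proof (rule transitive_face)
    show "?T \<noteq> {}"
    proof -
      obtain x where x: "x \<in> S" using S(2) by blast
      show ?thesis
      proof (cases x)
        case (Inl d)
        then show ?thesis using x S(1) by (auto simp: darts_K)
      next
        case (Inr d)
        then have "d \<in> P" using x S(1) by (auto simp: darts_K)
        then have "Inl d \<in> S" using S(3)[OF x] Inr by simp
        then show ?thesis using \<open>d \<in> P\<close> P_subset by blast
      qed
    qed
  next
    fix d assume d: "d \<in> ?T"
    show "opp M d \<in> ?T"
    proof (cases "d \<in> P")
      case True
      then have "Inr d \<in> S" using d S(3)[of "Inl d"] by simp
      then have "Inr (opp M d) \<in> S" using outer_back True by blast
      then show ?thesis using S(3)[of "Inr (opp M d)"] True d by simp
    next
      case False
      then show ?thesis using d S(3)[of "Inl d"] by simp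
    qed
  next
    fix d assume "d \<in> ?T"
    then show "face_next M d \<in> ?T" using fn[of "Inl d"] face_next_in by simp
  qed auto
  then have "Inl d \<in> S" if "d \<in> darts M" for d using that by blast
  moreover from this have "Inr d \<in> S" if "d \<in> P" for d
    using that S(3)[of "Inl d"] P_subset by auto
  ultimately show "S = darts K" using S(1) by (auto simp: darts_K)
qed (simp)

text \<open>The gluing map that undoes the cut. Since \<open>Inr d\<close> runs from the head of
  \<open>d\<close> to its tail, it covers \<open>opp M d\<close>.\<close>

definition proj :: "'d + 'd \<Rightarrow> 'd" where
  "proj x = (case x of Inl d \<Rightarrow> d | Inr d \<Rightarrow> opp M d)"

lemma proj_simps [simp]: "proj (Inl d) = d" "proj (Inr d) = opp M d"
  by (simp_all add: proj_def)

lemma proj_in: "x \<in> darts K \<Longrightarrow> proj x \<in> darts M"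
  using P_subset by (auto simp: darts_K)

lemma proj_opp: "x \<in> darts K \<Longrightarrow> proj (opp K x) = opp M (proj x)"
  by (auto simp: darts_K)

lemma vertex_proj_rot:
  assumes "x \<in> darts K"
  shows "vertex_of M (proj (rot K x)) = vertex_of M (proj x)"
proof (cases x)
  case (Inl d)
  then show ?thesis using vertex_outer_next by (simp add: rot_K_eq)
next
  case (Inr d)
  then have "d \<in> P" using assms by (auto simp: darts_K)
  then show ?thesis using Inr by (simp add: rot_K_eq face_next_def[of M])
qed

lemma vertex_proj:
  assumes "x \<in> darts K" "y \<in> vertex_of K x"
  shows "vertex_of M (proj y) = vertex_of M (proj x)"
proof (rule orbit_const[where f = "rot K" and g = "\<lambda>x. vertex_of M (proj x)"])
  show "y \<in> orbit (rot K) x" using assms by (simp add: vertex_of_def)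
  show "vertex_of M (proj (rot K z)) = vertex_of M (proj z)" if "z \<in> orbit (rot K) x \<or> z = x" for z
    using that assms(1) cut.vertex_of_subset vertex_proj_rot by (auto simp: vertex_of_def)
qed

lemma vertex_proj_eq:
  assumes "x \<in> darts K" "vertex_of K x = vertex_of K y"
  shows "vertex_of M (proj x) = vertex_of M (proj y)"
  using vertex_proj[OF assms(1), of y] assms(2) by simp

section \<open>Vertices, edges and faces of the cut map\<close>

lemma path_darts_at_inner_vertex:
  assumes i: "Suc i < n" and d: "d \<in> P" "vertex_of M d = vertex_of M (p ! Suc i)"
  shows "d = p ! Suc i \<or> d = opp M (p ! i)"
proof (cases rule: P_cases[OF d(1)])
  case (1 j)
  then show ?thesis using path_inj[of j "Suc i"] i d(2) by simp
next
  case (2 j)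
  show ?thesis
  proof (cases "Suc j < n")
    case True
    then have "Suc j = Suc i" using path_inj[of "Suc j" "Suc i"] path_step[of j] 2 d(2) i by simp
    then show ?thesis using 2 by simp
  next
    case False
    then have "j = n - 1" using 2 by simp
    then show ?thesis using path_end[of "Suc i"] 2 d(2) i by simp
  qed
qed

text \<open>An inner vertex of the path is split into two: the darts from \<open>opp (p ! i)\<close>
  (exclusive) to \<open>p ! Suc i\<close> (inclusive) in the rotation get separated from the rest.\<close>

lemma inner_vertex_split:
  assumes i: "Suc i < n"
  shows "vertex_of K (Inl (p ! Suc i)) \<noteq> vertex_of K (Inl (opp M (p ! i)))"
proof -
  let ?a = "opp M (p ! i)" and ?b = "p ! Suc i"
  have ab: "?a \<noteq> ?b" using opp_nth_neq i by simp
  have v: "vertex_of M ?a = vertex_of M ?b" using path_step i by simp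
  have "?b \<in> orbit (rot M) ?a"
    using v vertex_of_eq_iff[of ?b ?a] by (simp add: vertex_of_def)
  then obtain m where m: "0 < m" "(rot M ^^ m) ?a = ?b"
      "\<And>k. 0 < k \<Longrightarrow> k < m \<Longrightarrow> (rot M ^^ k) ?a \<notin> {?a, ?b}"
    using permutation_sector by metis
  \<comment> \<open>The new dart \<open>Inr (p ! i)\<close> closes the sector into a cycle of
    \<open>rot K\<close>: it follows \<open>Inl ?b\<close> and precedes
    \<open>Inl (rot M ?a)\<close>.\<close>
  define S where "S = insert (Inr (p ! i)) ((\<lambda>k. Inl ((rot M ^^ k) ?a)) ` {1..m})"
  have "rot K x \<in> S" if x: "x \<in> S" for x
  proof (cases "x = Inr (p ! i)")
    case True
    have "p ! i \<in> P" using i nth_in_P by simp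
    then have "rot K x = Inl ((rot M ^^ 1) ?a)" using True by (simp add: rot_K_eq face_next_def[of M])
    then show ?thesis using m(1) unfolding S_def by (intro insertI2 image_eqI[of _ _ 1]) auto
  next
    case False
    then have "x \<in> (\<lambda>k. Inl ((rot M ^^ k) ?a)) ` {1..m}" using x by (simp add: S_def)
    then obtain k where "k \<in> {1..m}" "x = Inl ((rot M ^^ k) ?a)" by blast
    then have k: "1 \<le> k" "k \<le> m" "x = Inl ((rot M ^^ k) ?a)" by auto
    show ?thesis
    proof (cases "k = m")
      case True
      then have "rot K x = Inr (p ! i)"
        using k m(2) i nth_in_P outer_next_Suc by (simp add: rot_K_eq)
      then show ?thesis by (simp add: S_def)
    next
      case False
      then have "(rot M ^^ k) ?a \<notin> {?a, ?b}" using m(3) k by simp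
      moreover have "vertex_of M ((rot M ^^ k) ?a) = vertex_of M ?b"
        using v by (induction k) auto
      ultimately have "(rot M ^^ k) ?a \<notin> P" using path_darts_at_inner_vertex[OF i] by blast
      then have "rot K x = Inl ((rot M ^^ Suc k) ?a)" using k by (simp add: rot_K_eq)
      then show ?thesis
        using k False unfolding S_def by (intro insertI2 image_eqI[of _ _ "Suc k"]) auto
    qed
  qed
  moreover have "Inl ?b \<in> S"
    using m(1,2) unfolding S_def by (intro insertI2 image_eqI[of _ _ m]) auto
  ultimately have "vertex_of K (Inl ?b) \<subseteq> S"
    unfolding vertex_of_def by (rule orbit_closed_subset[rotated])
  moreover have "Inl ?a \<notin> S"
  proof
    assume "Inl ?a \<in> S"
    then obtain k where "k \<in> {1..m}" "(rot M ^^ k) ?a = ?a" by (auto simp: S_def)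
    then show False using m(2) m(3)[of k] ab by (cases "k = m") auto
  qed
  ultimately show ?thesis using cut.mem_vertex_of by blast
qed

text \<open>Gluing maps the vertices of \<open>K\<close> onto those of \<open>M\<close>, and stays
  onto when one copy of each of the \<open>n - 1\<close> inner path vertices is removed. With at
  most \<open>n\<close> more edges and at least one more face, the inequality V + F >= E + 2
  survives the cut.\<close>

lemma card_vertices_K: "card cut.vertices \<ge> card vertices + (n - 1)"
proof -
  define r where "r i = vertex_of K (Inl (opp M (p ! i)))" for i
  \<comment> \<open>The choice is harmless: all darts of a vertex of \<open>K\<close> project to the
    same vertex.\<close>
  define q where "q X = vertex_of M (proj (SOME x. x \<in> X))" for X
  define W where "W = r ` {..<n - 1}"
  have q: "q (vertex_of K x) = vertex_of M (proj x)" if "x \<in> darts K" for x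
  proof -
    have "(SOME y. y \<in> vertex_of K x) \<in> vertex_of K x" by (rule someI[of _ x]) simp
    then show ?thesis unfolding q_def using vertex_proj that by blast
  qed
  have in_K: "Inl d \<in> darts K \<longleftrightarrow> d \<in> darts M" for d by (auto simp: darts_K)
  have q_r: "q (r i) = vertex_of M (p ! Suc i)" if "i < n - 1" for i
    using q[of "Inl (opp M (p ! i))"] path_in[of i] path_step[of i] that by (simp add: r_def in_K)
  have "inj_on r {..<n - 1}"
  proof (rule inj_onI)
    fix i j assume "i \<in> {..<n - 1}" "j \<in> {..<n - 1}" "r i = r j"
    then show "i = j" using q_r[of i] q_r[of j] path_inj[of "Suc i" "Suc j"] by simp
  qed
  then have card_W: "card W = n - 1" by (simp add: W_def card_image)
  have W_sub: "W \<subseteq> cut.vertices"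
    using path_in by (auto simp: W_def r_def cut.vertices_def in_K)
  have fin: "finite cut.vertices" using cut.finite_darts by (simp add: cut.vertices_def)
  have "vertices \<subseteq> q ` (cut.vertices - W)"
  proof
    fix v assume "v \<in> vertices"
    then obtain d where d: "d \<in> darts M" "v = vertex_of M d" by (auto simp: vertices_def)
    show "v \<in> q ` (cut.vertices - W)"
    proof (cases "vertex_of K (Inl d) \<in> W")
      case False
      then have "vertex_of K (Inl d) \<in> cut.vertices - W"
        using d by (simp add: cut.vertices_def in_K)
      moreover have "q (vertex_of K (Inl d)) = v" using q[of "Inl d"] d by (simp add: in_K)
      ultimately show ?thesis by blast
    next
      case True
      then obtain i where i: "i < n - 1" "vertex_of K (Inl d) = r i" by (auto simp: W_def)
      have b: "p ! Suc i \<in> darts M" using i path_in by simp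
      have v: "v = vertex_of M (p ! Suc i)" using q[of "Inl d"] d i q_r[of i] by (simp add: in_K)
      \<comment> \<open>\<open>W\<close> contains only one of the two copies of an inner vertex; the
        other one remains as a preimage.\<close>
      have "vertex_of K (Inl (p ! Suc i)) \<notin> W"
      proof
        assume "vertex_of K (Inl (p ! Suc i)) \<in> W"
        then obtain j where j: "j < n - 1" "vertex_of K (Inl (p ! Suc i)) = r j"
          by (auto simp: W_def)
        then have "vertex_of M (p ! Suc i) = vertex_of M (p ! Suc j)"
          using q[of "Inl (p ! Suc i)"] b q_r[of j] by (simp add: in_K)
        then have "i = j" using path_inj[of "Suc i" "Suc j"] i j by simp
        moreover have "Suc i < n" using i(1) by simp
        ultimately show False using j(2) inner_vertex_split unfolding r_def by blast
      qed
      moreover have "vertex_of K (Inl (p ! Suc i)) \<in> cut.vertices"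
        using b by (simp add: cut.vertices_def in_K)
      moreover have "q (vertex_of K (Inl (p ! Suc i))) = v"
        using q[of "Inl (p ! Suc i)"] b v by (simp add: in_K)
      ultimately show ?thesis by blast
    qed
  qed
  then have "card vertices \<le> card (cut.vertices - W)"
    using surj_card_le[OF finite_Diff[OF fin]] by blast
  then show ?thesis
    using card_W card_Diff_subset[OF finite_subset[OF W_sub fin] W_sub] card_mono[OF fin W_sub]
    by linarith
qed

lemma card_edges_K: "card (edges K) \<le> card (edges M) + n"
proof -
  have "card P \<le> card (set p) + card (opp M ` set p)"
    unfolding path_darts_def by (rule card_Un_le)
  also have "\<dots> \<le> n + n"
    using card_length[of p] card_image_le[of "set p" "opp M"] by simp
  finally have "card P \<le> n + n" .
  moreover have "card (darts K) = card (darts M) + card P"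
    using finite_darts finite_P by (simp add: darts_K card_Plus)
  ultimately show ?thesis using card_darts cut.card_darts by simp
qed

text \<open>The old faces survive as orbits because \<open>face_next K\<close> acts on the
  \<open>Inl\<close> darts as \<open>face_next M\<close>; the outer face is different from them
  since it contains a new dart.\<close>

lemma card_faces_K: "card (faces K) \<ge> card (faces M) + 1"
proof -
  have face: "orbit (face_next K) (Inl d) = Inl ` orbit (face_next M) d" for d
    by (rule orbit_inverse[symmetric]) auto
  let ?outer = "orbit (face_next K) (Inr (p ! 0))"
  have "?outer \<in> faces K"
    using nth_in_P path_nonempty by (auto simp: faces_def darts_K)
  moreover have "(\<lambda>F. Inl ` F) ` faces M \<subseteq> faces K"
    using face by (auto simp: faces_def darts_K)
  ultimately have sub: "insert ?outer ((\<lambda>F. Inl ` F) ` faces M) \<subseteq> faces K" by simp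
  have "?outer \<notin> (\<lambda>F. Inl ` F) ` faces M"
  proof
    assume "?outer \<in> (\<lambda>F. Inl ` F) ` faces M"
    then show False using cut.mem_face[of "Inr (p ! 0)"] by (elim imageE) (metis Inl_Inr_False imageE)
  qed
  moreover have "inj_on (\<lambda>F. Inl ` F :: ('d + 'd) set) (faces M)"
    by (rule inj_onI) (simp add: inj_image_eq_iff)
  moreover have "finite (faces M)" "finite (faces K)"
    using finite_darts cut.finite_darts by (simp_all add: faces_def)
  ultimately show ?thesis
    using card_mono[OF _ sub] by (simp add: card_image)
qed

section \<open>Transfer of 2-cycles between the map and the cut map\<close>

lemma outer_const:
  assumes f: "\<And>d. d \<in> P \<Longrightarrow> f (outer_next d) = f d" and d: "d \<in> P"
  shows "f d = f (p ! 0)"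
proof -
  have a: "f (p ! i) = f (p ! 0)" if "i < n" for i
    using that by (induction i) (use f nth_in_P outer_next_Suc in \<open>metis Suc_lessD\<close>)+
  have "f (opp M (p ! i)) = f (p ! 0)" if "i < n" for i
    using that
  proof (induction i)
    case 0
    then show ?case using f[of "p ! 0"] nth_in_P outer_next_0 by simp
  next
    case (Suc i)
    then show ?case using f[of "opp M (p ! i)"] nth_in_P outer_next_opp by simp
  qed
  then show ?thesis using a P_cases[OF d] by metis
qed

lemma edge_pair_proj:
  assumes "x \<in> darts K" "y \<in> darts K" "z \<in> cut.edge_pair x y"
  shows "proj z \<in> edge_pair (proj x) (proj y)"
  using assms(3) proj_opp[OF assms(1)] proj_opp[OF assms(2)]
  unfolding cut.edge_pair_def edge_pair_def by fastforce

text \<open>\<open>Y\<close> is the side of the 2-cycle that does not contain the outer face of the cut map.\<close>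

lemma two_cycle_in_cut_map:
  assumes euler: "card vertices + card (faces M) = card (edges M) + 2"
    and loopfree: "\<And>d. d \<in> darts M \<Longrightarrow> vertex_of M d \<noteq> vertex_of M (opp M d)"
    and n: "n \<ge> 2"
    and cyc: "two_cycle (graph K) (opp K) C"
  obtains a b Y where "parallel a b" "Y \<subseteq> darts M" "Y \<inter> edge_pair a b \<noteq> {}"
    "\<And>d. d \<in> Y \<Longrightarrow> face_next M d \<in> Y" "\<And>d. d \<in> Y - edge_pair a b \<Longrightarrow> opp M d \<in> Y"
    "P \<inter> Y \<subseteq> edge_pair a b"
proof -
  obtain x y where xy: "cut.parallel x y" and C: "C = cut.edge_pair x y"
    using cyc cut.two_cycle_iff by auto
  have in_K: "x \<in> darts K" "y \<in> darts K" using xy by (auto simp: cut.parallel_def)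
  have "card cut.vertices + card (faces K) \<ge> card (edges K) + 2"
    using card_vertices_K card_edges_K card_faces_K euler n by linarith
  then obtain f where f_face: "\<And>d. d \<in> darts K \<Longrightarrow> f (face_next K d) = f d"
    and f_opp: "\<And>d. d \<in> darts K \<Longrightarrow> f (opp K d) \<noteq> (f d :: bool) \<longleftrightarrow> d \<in> C"
    using cut.even_set_separates[OF _ cut.edge_pair_even[OF xy]] C by blast
  have inl: "Inl d \<in> darts K \<longleftrightarrow> d \<in> darts M" and inr: "Inr d \<in> darts K \<longleftrightarrow> d \<in> P" for d
    by (auto simp: darts_K)
  \<comment> \<open>The value of the separating function on the outer face; \<open>Y\<close> below
    collects the old faces with the other value.\<close>
  define c where "c = f (Inr (p ! 0))"
  have f_out: "f (Inr d) = c" if "d \<in> P" for d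
    unfolding c_def
  proof (rule outer_const[OF _ that])
    show "f (Inr (outer_next e)) = f (Inr e)" if "e \<in> P" for e
      using f_face[of "Inr e"] that by (simp add: inr)
  qed
  define Y where "Y = {d \<in> darts M. f (Inl d) \<noteq> c}"
  let ?a = "proj x" and ?b = "proj y"
  have proj_C: "d \<in> edge_pair ?a ?b" if "Inl d \<in> C" for d
    using edge_pair_proj[OF in_K] that C by fastforce
  have Y_face: "face_next M d \<in> Y" if "d \<in> Y" for d
    using that f_face[of "Inl d"] face_next_in by (simp add: Y_def inl)
  \<comment> \<open>Beyond a path dart lies the outer face, where \<open>f\<close> is
    \<open>c\<close>; so a dart of \<open>Y\<close> that is not in the cycle cannot be on the
    path.\<close>
  have Y_opp': "opp M d \<in> Y" if "d \<in> Y" "Inl d \<notin> C" for d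
  proof -
    have "f (opp K (Inl d)) \<noteq> c" using that f_opp[of "Inl d"] by (auto simp: Y_def inl)
    then have "d \<notin> P" using f_out by auto
    then show ?thesis using \<open>f (opp K (Inl d)) \<noteq> c\<close> that by (simp add: Y_def)
  qed
  have Y_P: "Inl d \<in> C" if "d \<in> Y" "d \<in> P" for d
    using that f_opp[of "Inl d"] f_out[of d] by (auto simp: Y_def inl)
  have v: "vertex_of M ?a = vertex_of M ?b" "vertex_of M (opp M ?a) = vertex_of M (opp M ?b)"
    using xy vertex_proj_eq[of x y] vertex_proj_eq[of "opp K x" "opp K y"] in_K
    by (auto simp: cut.parallel_def proj_opp)
  have ab_in: "?a \<in> darts M" "?b \<in> darts M" using in_K proj_in by auto
  \<comment> \<open>\<open>f\<close> changes across the edge of \<open>x\<close>, so one of its two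
    darts does not have the value of the outer face.\<close>
  have "\<exists>z\<in>C. f z \<noteq> c"
  proof -
    have "x \<in> C" "opp K x \<in> C" by (auto simp: C cut.edge_pair_def)
    then show ?thesis using f_opp[OF in_K(1)] by metis
  qed
  then obtain z where z: "z \<in> C" "f z \<noteq> c" by blast
  have zK: "z \<in> darts K" using z(1) in_K by (auto simp: C cut.edge_pair_def)
  obtain d where d: "z = Inl d" using zK z f_out by (cases z) (auto simp: inr)
  have dY: "d \<in> Y" using z(2) zK d by (simp add: Y_def inl)
  \<comment> \<open>Otherwise \<open>x\<close> and \<open>y\<close> are the two banks of one path
    edge. Then \<open>Y\<close> is closed under \<open>opp M\<close>, hence contains all darts, and
    every path edge is this one, against \<open>n \<ge> 2\<close>.\<close>
  have ab: "?a \<noteq> ?b"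
  proof
    assume eq: "?a = ?b"
    have x_y: "x \<noteq> y" using xy by (simp add: cut.parallel_def)
    have pair: "edge_pair ?a ?b = {?a, opp M ?a}" using eq by (auto simp: edge_pair_def)
    have opp_Y: "opp M e \<in> Y" if e: "e \<in> Y" for e
    proof (cases "Inl e \<in> C")
      case True
      then have "e \<in> {?a, opp M ?a}" using proj_C pair by blast
      define a where "a = ?a"
      have "(x = Inl a \<and> y = Inr (opp M a) \<or> x = Inr (opp M a) \<and> y = Inl a) \<and> a \<in> P"
        using x_y eq in_K unfolding a_def
        by (cases x; cases y) (auto simp: inl inr dest: arg_cong[of _ _ "opp M"])
      then have "a \<in> P" "C = {Inl a, Inr a, Inr (opp M a), Inl (opp M a)}"
        by (auto simp: C cut.edge_pair_def)
      then have "opp M e \<in> P" "Inl (opp M e) \<in> C" using \<open>e \<in> {?a, opp M ?a}\<close> by (auto simp: a_def)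
      \<comment> \<open>The opposite dart \<open>Inr (opp M e)\<close> is on the outer face, and
        \<open>f\<close> changes across edges of \<open>C\<close>.\<close>
      then have "f (Inl (opp M e)) \<noteq> c" 
        using f_opp[of "Inl (opp M e)"] f_out[of "opp M e"] P_subset by (auto simp: inl)
      then show ?thesis using e by (simp add: Y_def)
    next
      case False
      then show ?thesis using Y_opp' e by blast
    qed
    have "Y = darts M"
      using transitive_face[of Y] dY Y_face opp_Y unfolding Y_def by blast
    then have "P \<subseteq> edge_pair ?a ?b" using Y_P proj_C P_subset by blast
    moreover have n01: "0 < n" "1 < n" using n by auto
    ultimately have "p ! 0 \<in> {?a, opp M ?a}" "p ! 1 \<in> {?a, opp M ?a}"
      using nth_in_P pair by blast+
    moreover have "opp M (p ! 0) \<noteq> p ! 1" "opp M (p ! 1) \<noteq> p ! 0"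
      using opp_nth_neq n01 by blast+
    moreover have "p ! 0 \<noteq> p ! 1" using path_inj[of 0 1] n01 by auto
    ultimately show False by auto
  qed
  show ?thesis
  proof (rule that)
    show "parallel ?a ?b" using ab ab_in v loopfree by (simp add: parallel_def)
    show "Y \<subseteq> darts M" by (auto simp: Y_def)
    show "Y \<inter> edge_pair ?a ?b \<noteq> {}" using dY proj_C z(1) d by blast
    show "face_next M d \<in> Y" if "d \<in> Y" for d by (rule Y_face[OF that])
    show "opp M d \<in> Y" if "d \<in> Y - edge_pair ?a ?b" for d using Y_opp' proj_C that by blast
    show "P \<inter> Y \<subseteq> edge_pair ?a ?b" using Y_P proj_C by blast
  qed
qed

text \<open>As \<open>rot M a = face_next M (opp M a)\<close>, the angle after \<open>a\<close>
  belongs to \<open>X\<close>. Turning further from \<open>a\<close> to \<open>b\<close> crosses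
  only edges off the 2-cycle, because \<open>opp M a\<close> and \<open>opp M b\<close> leave
  another vertex, and so stays in \<open>X\<close>.\<close>

lemma (in combinatorial_map) parallel_sector:
  assumes ab: "parallel a b"
    and X: "opp M a \<in> X" "\<And>d. d \<in> X \<Longrightarrow> face_next M d \<in> X"
      "\<And>d. d \<in> X - edge_pair a b \<Longrightarrow> opp M d \<in> X"
  obtains m where "0 < m" "(rot M ^^ m) a = b" "\<And>k. 0 < k \<Longrightarrow> k \<le> m \<Longrightarrow> (rot M ^^ k) a \<in> X"
    "\<And>k. 0 < k \<Longrightarrow> k < m \<Longrightarrow> (rot M ^^ k) a \<notin> edge_pair a b"
proof -
  have ab': "vertex_of M a = vertex_of M b" "vertex_of M a \<noteq> vertex_of M (opp M a)"
      "vertex_of M (opp M a) = vertex_of M (opp M b)"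
    using ab by (auto simp: parallel_def)
  have "b \<in> orbit (rot M) a"
    using ab'(1) vertex_of_eq_iff[of b a] by (simp add: vertex_of_def)
  then obtain m where m: "0 < m" "(rot M ^^ m) a = b"
      "\<And>k. 0 < k \<Longrightarrow> k < m \<Longrightarrow> (rot M ^^ k) a \<notin> {a, b}"
    using permutation_sector by metis
  have off: "(rot M ^^ k) a \<notin> edge_pair a b" if "0 < k" "k < m" for k
  proof -
    have "vertex_of M ((rot M ^^ k) a) = vertex_of M a"
      by (induction k) auto
    then have "(rot M ^^ k) a \<noteq> opp M a" "(rot M ^^ k) a \<noteq> opp M b" using ab' by metis+
    then show ?thesis using m(3)[OF that] by (simp add: edge_pair_def)
  qed
  have "(rot M ^^ Suc k) a \<in> X" if "Suc k \<le> m" for k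
    using that
  proof (induction k)
    case 0
    show ?case using X(2)[OF X(1)] by simp
  next
    case (Suc k)
    then have "opp M ((rot M ^^ Suc k) a) \<in> X" using X(3) off[of "Suc k"] by simp
    then show ?case using X(2)[of "opp M ((rot M ^^ Suc k) a)"] by simp
  qed
  then have "(rot M ^^ k) a \<in> X" if "0 < k" "k \<le> m" for k
    using that by (metis Suc_pred)
  then show ?thesis using that m off by blast
qed

text \<open>One implication uses the angle at the common tail, the other the angle at the common
  head, where \<open>opp M b\<close> and \<open>opp M a\<close> take the roles of \<open>a\<close>
  and \<open>b\<close>.\<close>

lemma (in combinatorial_map) parallel_closed_iff:
  assumes ab: "parallel a b"
    and X: "\<And>d. d \<in> X \<Longrightarrow> face_next M d \<in> X" "\<And>d. d \<in> X - edge_pair a b \<Longrightarrow> opp M d \<in> X"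
  shows "opp M a \<in> X \<longleftrightarrow> b \<in> X"
proof
  assume "opp M a \<in> X"
  then obtain m where "0 < m" "(rot M ^^ m) a = b"
      "\<And>k. 0 < k \<Longrightarrow> k \<le> m \<Longrightarrow> (rot M ^^ k) a \<in> X"
    using parallel_sector[OF ab _ X] by metis
  then show "b \<in> X" by (metis order_refl)
next
  assume b: "b \<in> X"
  have ba: "parallel (opp M b) (opp M a)" using ab parallel_sym parallel_opp by blast
  have "edge_pair (opp M b) (opp M a) = edge_pair a b" by (auto simp: edge_pair_def)
  then obtain m where "0 < m" "(rot M ^^ m) (opp M b) = opp M a"
      "\<And>k. 0 < k \<Longrightarrow> k \<le> m \<Longrightarrow> (rot M ^^ k) (opp M b) \<in> X"
    using parallel_sector[OF ba, of X] b X by (metis opp_opp)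
  then show "opp M a \<in> X" by (metis order_refl)
qed

text \<open>\<open>opp K (Inl (opp M a))\<close> is the copy of \<open>a\<close> that borders
  \<open>X\<close>. No path dart lies strictly within the angle from \<open>a\<close> to
  \<open>b\<close> in \<open>X\<close>, so the cut leaves this angle in one piece.\<close>

lemma vertex_lift:
  assumes ab: "parallel a b"
    and X: "X \<subseteq> darts M" "opp M a \<in> X" "\<And>d. d \<in> X \<Longrightarrow> face_next M d \<in> X"
      "\<And>d. d \<in> X - edge_pair a b \<Longrightarrow> opp M d \<in> X"
    and P: "P \<inter> X \<subseteq> edge_pair a b"
  shows "vertex_of K (opp K (Inl (opp M a))) = vertex_of K (Inl b)"
proof -
  obtain m where m: "0 < m" "(rot M ^^ m) a = b" "\<And>k. 0 < k \<Longrightarrow> k \<le> m \<Longrightarrow> (rot M ^^ k) a \<in> X"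
      "\<And>k. 0 < k \<Longrightarrow> k < m \<Longrightarrow> (rot M ^^ k) a \<notin> edge_pair a b"
    using parallel_sector[OF ab X(2-4)] by metis
  have start: "rot K (opp K (Inl (opp M a))) = Inl (rot M a)"
    by (simp only: rot_K_eq opp_opp_K face_next_K face_next_opp)
  have "Inl ((rot M ^^ Suc k) a) \<in> vertex_of K (opp K (Inl (opp M a)))" if "Suc k \<le> m" for k
    using that
  proof (induction k)
    case 0
    have "Inl (rot M a) \<in> vertex_of K (opp K (Inl (opp M a)))"
      unfolding vertex_of_def start[symmetric] by (rule orbit.base)
    then show ?case by simp
  next
    case (Suc k)
    let ?d = "(rot M ^^ Suc k) a"
    have "?d \<in> X" "?d \<notin> edge_pair a b" using m(3,4)[of "Suc k"] Suc.prems by auto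
    then have "?d \<notin> P" using P by blast
    then have "rot K (Inl ?d) = Inl (rot M ?d)" by (simp add: rot_K_eq)
    moreover have "Inl ?d \<in> vertex_of K (opp K (Inl (opp M a)))" using Suc by simp
    then have "rot K (Inl ?d) \<in> vertex_of K (opp K (Inl (opp M a)))"
      unfolding vertex_of_def by (rule orbit.step)
    ultimately show ?case by simp
  qed
  from this[of "m - 1"] have "Inl b \<in> vertex_of K (opp K (Inl (opp M a)))"
    using m(1,2) by simp
  then show ?thesis using cut.vertex_of_eq by metis
qed

text \<open>Of each edge the copy bordering \<open>X\<close> is taken, and
  \<open>vertex_lift\<close> is applied at both ends of the 2-cycle.\<close>

lemma two_cycle_lift:
  assumes ab: "parallel a b"
    and X: "X \<subseteq> darts M" "opp M a \<in> X" "\<And>d. d \<in> X \<Longrightarrow> face_next M d \<in> X"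
      "\<And>d. d \<in> X - edge_pair a b \<Longrightarrow> opp M d \<in> X"
    and P: "P \<inter> X \<subseteq> edge_pair a b"
  shows "\<exists>C. two_cycle (graph K) (opp K) C"
proof -
  have ab': "a \<in> darts M" "b \<in> darts M" "vertex_of M a \<noteq> vertex_of M (opp M a)" "a \<noteq> b"
      "vertex_of M (opp M a) = vertex_of M (opp M b)"  "vertex_of M a = vertex_of M b"
    using ab by (auto simp: parallel_def)
  let ?x = "opp K (Inl (opp M a))" and ?y = "Inl b"
  have b: "b \<in> X" using parallel_closed_iff[OF ab X(3,4)] X(2) by blast
  have 1: "vertex_of K ?x = vertex_of K ?y" by (rule vertex_lift[OF ab X P])
  have "parallel (opp M b) (opp M a)" using ab parallel_opp parallel_sym by blast
  then have "vertex_of K (opp K (Inl (opp M (opp M b)))) = vertex_of K (Inl (opp M a))"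
    by (rule vertex_lift) (use X b P edge_pair_sym edge_pair_opp in \<open>auto simp: edge_pair_opp\<close>)
  moreover have opp_x: "opp K ?x = Inl (opp M a)" by (simp only: opp_opp_K)
  ultimately have 2: "vertex_of K (opp K ?x) = vertex_of K (opp K ?y)" by simp
  have in_K: "?y \<in> darts K" "opp K ?x \<in> darts K" using ab' unfolding opp_x by (auto simp: darts_K)
  have "vertex_of K ?y \<noteq> vertex_of K (opp K ?x)"
  proof
    assume "vertex_of K ?y = vertex_of K (opp K ?x)"
    then have "vertex_of M (proj ?y) = vertex_of M (proj (opp K ?x))" using in_K vertex_proj_eq by blast
    then show False using ab' unfolding opp_x by simp
  qed
  moreover have "?x \<noteq> ?y"
  proof
    assume "?x = ?y"
    then have "proj ?x = proj ?y" by simp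
    then show False using ab' by (auto split: if_splits)
  qed
  ultimately have "cut.parallel ?x ?y" using 1 2 in_K by (auto simp: cut.parallel_def)
  then show ?thesis using cut.two_cycle_iff by blast
qed

end

section \<open>Sides without marked vertices in lopsp-operations\<close>

text \<open>For transitivity: a set closed under \<open>rot\<close> contains every vertex that it
  meets, and closure under \<open>opp\<close> lets it follow reachability in the graph.\<close>

lemma combinatorial_map_if_is_map:
  assumes "is_map M"
  shows "combinatorial_map M"
proof -
  have fin: "finite (darts M)" and rot: "rot M permutes darts M" and con: "connected (graph M)"
    and bi: "bidirected_digraph (graph M) (opp M)"
    using assms by (auto simp: is_map_def)
  interpret bidirected_digraph "graph M" "opp M" by (rule bi)
  have arcs: "arcs (graph M) = darts M" by (simp add: graph_def)
  have self: "d \<in> vertex_of M d" for d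
    unfolding vertex_of_def using mem_orbit rot fin by metis
  show ?thesis
  proof
    show "finite (darts M)" "rot M permutes darts M" by fact+
    show "opp M d = d" if "d \<notin> darts M" for d using that arev_eq arcs by simp
    show "opp M (opp M d) = d" for d by simp
    show "opp M d \<noteq> d" if "d \<in> darts M" for d using that arev_neq arcs by simp
    fix S assume S: "S \<subseteq> darts M" "S \<noteq> {}" "\<And>d. d \<in> S \<Longrightarrow> opp M d \<in> S" "\<And>d. d \<in> S \<Longrightarrow> rot M d \<in> S"
    have vertex_S: "vertex_of M d \<subseteq> S" if "d \<in> S" for d
      unfolding vertex_of_def using that S(4) by (rule orbit_closed_subset)
    have mem: "e \<in> vertex_of M d \<longleftrightarrow> vertex_of M e = vertex_of M d" for d e
      using self orbit_eq_of_mem[OF rot fin] unfolding vertex_of_def by metis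
    obtain d where d: "d \<in> S" using S(2) by blast
    have "e \<in> S" if e: "e \<in> darts M" for e
    proof -
      have "vertex_of M d \<rightarrow>\<^sup>*\<^bsub>mk_symmetric (graph M)\<^esub> vertex_of M e"
        using con d e S(1) unfolding connected_def strongly_connected_def
        by (auto simp: graph_def mk_symmetric_def)
      then have "(vertex_of M d, vertex_of M e) \<in>
          rtrancl_on (verts (graph M)) (parcs (mk_symmetric (graph M)))"
        by (simp add: reachable_def mk_symmetric_def)
      then have "vertex_of M e \<subseteq> S"
      proof (induction rule: rtrancl_on_induct)
        case base
        then show ?case using vertex_S d by blast
      next
        case (step y z)
        then obtain a where a: "a \<in> darts M" "y = vertex_of M a \<and> z = vertex_of M (opp M a)
            \<or> z = vertex_of M a \<and> y = vertex_of M (opp M a)"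
          by (auto simp: parcs_mk_symmetric graph_def)
        then show ?case using step.IH self vertex_S S(3) arev_arev by (metis subsetD)
      qed
      then show ?thesis using self by blast
    qed
    then show "S = darts M" using S(1) by blast
  qed
qed

section \<open>Sides as minimal closed sets of darts\<close>

context combinatorial_map
begin

abbreviation side_closed :: "'d set \<Rightarrow> 'd set \<Rightarrow> bool" where
  "side_closed C X \<equiv> (\<forall>d\<in>X. face_next M d \<in> X) \<and> (\<forall>d\<in>X - C. opp M d \<in> X)"

lemma sides_class:
  assumes "X \<in> sides M C"
  shows "X \<subseteq> darts M" "X \<noteq> {}" "side_closed C X"
proof -
  let ?R = "(side_step M C \<union> (side_step M C)\<inverse>)\<^sup>*"
  obtain d where d: "d \<in> darts M" "X = ?R `` {d}"
    using assms by (auto simp: sides_def elim: quotientE)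
  have "e \<in> darts M" if "(d, e) \<in> ?R" for e
    using that d(1)
    by (induction rule: rtrancl_induct) (auto simp: side_step_def face_next_in)
  then show X: "X \<subseteq> darts M" using d by blast
  show "X \<noteq> {}" using d by blast
  have step: "f \<in> X" if "e \<in> X" "(e, f) \<in> side_step M C" for e f
    using that d by (auto intro: rtrancl_into_rtrancl)
  show "side_closed C X"
    using X step unfolding side_step_def by blast
qed

text \<open>Sides are classes of a symmetric relation, but closure forwards is enough:
  \<open>face_next M\<close> is injective on the finite set \<open>Y\<close>, hence \<open>Y\<close>
  is closed under its inverse too, and \<open>opp M\<close> is an involution that preserves
  \<open>C\<close>.\<close>

lemma side_subset:
  assumes X: "X \<in> sides M C" and C: "opp M ` C \<subseteq> C"
    and Y: "Y \<subseteq> darts M" "side_closed C Y" and d: "d \<in> X" "d \<in> Y"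
  shows "X \<subseteq> Y"
proof -
  let ?R = "(side_step M C \<union> (side_step M C)\<inverse>)\<^sup>*"
  have sym: "sym ?R" by (intro sym_rtrancl sym_Un_converse)
  obtain x where x: "X = ?R `` {x}" using X by (auto simp: sides_def elim: quotientE)
  have fin: "finite Y" using Y(1) finite_darts finite_subset by blast
  have "face_next M ` Y = Y"
    using Y(2) fin permutes_inj[OF face_next_permutes]
    by (metis endo_inj_surj image_subsetI inj_on_subset subset_UNIV)
  then have prev: "e \<in> Y" if "face_next M e \<in> Y" for e
    using that permutes_inj[OF face_next_permutes] by (metis imageE injD)
  have "e \<in> Y" if "(d, e) \<in> ?R" for e
    using that
  proof (induction rule: rtrancl_induct)
    case (step y z)
    from step.hyps(2) consider "z = face_next M y" | "y \<notin> C" "z = opp M y" 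
      | "y = face_next M z" | "z \<notin> C" "y = opp M z"
      by (auto simp: side_step_def)
    then show ?case
    proof cases
      case 1
      then show ?thesis using step.IH Y(2) by blast
    next
      case 2
      then show ?thesis using step.IH Y(2) by blast
    next
      case 3
      then show ?thesis using step.IH prev by blast
    next
      case 4
      then have "y \<notin> C" using C by (metis image_subset_iff opp_opp)
      then have "opp M y \<in> Y" using step.IH Y(2) by blast
      then show ?thesis using 4 by simp
    qed
  qed (use d in auto)
  moreover have "(d, e) \<in> ?R" if "e \<in> X" for e
  proof -
    have mem: "f \<in> X \<longleftrightarrow> (x, f) \<in> ?R" for f unfolding x by (rule Image_singleton_iff)
    have xd: "(x, d) \<in> ?R" by (rule mem[THEN iffD1, OF d(1)])
    have xe: "(x, e) \<in> ?R" by (rule mem[THEN iffD1, OF that])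
    show ?thesis by (rule rtrancl_trans[OF symD[OF sym xd] xe])
  qed
  ultimately show ?thesis by blast
qed

lemma side_exists: "d \<in> darts M \<Longrightarrow> \<exists>X\<in>sides M C. d \<in> X"
  unfolding sides_def by (intro bexI[OF _ quotientI]) auto

lemma edge_pair_symmetric: "opp M ` edge_pair a b \<subseteq> edge_pair a b"
  by (auto simp: edge_pair_def)

text \<open>A side that misses the cycle would be closed under \<open>opp M\<close> and so be the
  whole map. The two alternatives tell whether the side fills the angle from \<open>a\<close> to
  \<open>b\<close> or the one from \<open>b\<close> to \<open>a\<close>.\<close>

lemma side_meets_edge_pair:
  assumes X: "X \<in> sides M (edge_pair a b)" and ab: "parallel a b"
  shows "opp M a \<in> X \<and> b \<in> X \<or> opp M b \<in> X \<and> a \<in> X"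
proof -
  note cl = sides_class[OF X]
  have "X \<inter> edge_pair a b \<noteq> {}"
  proof
    assume disj: "X \<inter> edge_pair a b = {}"
    then have "X = darts M" using cl by (intro transitive_face) auto
    then show False using disj ab by (auto simp: parallel_def edge_pair_def)
  qed
  moreover have "opp M a \<in> X \<longleftrightarrow> b \<in> X"
    using cl(3) by (intro parallel_closed_iff[OF ab]) auto
  moreover have "opp M b \<in> X \<longleftrightarrow> a \<in> X"
    using cl(3) edge_pair_sym[of a b] by (intro parallel_closed_iff[OF parallel_sym[OF ab]]) auto
  ultimately show ?thesis by (auto simp: edge_pair_def)
qed

end

section \<open>Triangles, colours and enlarging an unmarked side\<close>

locale lopsp =
  fixes L :: "'d lopsp"
  assumes lopsp: "lopsp_operation L"
begin

sublocale combinatorial_map L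
  using lopsp by (intro combinatorial_map_if_is_map) (simp add: lopsp_operation_def plane_map_def)

sublocale graph: bidirected_digraph "graph L" "opp L"
  using lopsp by (simp add: lopsp_operation_def plane_map_def is_map_def)

lemma graph_simps [simp]:
  "verts (graph L) = vertices" "arcs (graph L) = darts L"
  "tail (graph L) d = vertex_of L d" "head (graph L) d = vertex_of L (opp L d)"
  by (simp_all add: graph_def vertices_def)

lemma vertex_in [simp]: "d \<in> darts L \<Longrightarrow> vertex_of L d \<in> vertices"
  by (simp add: vertices_def)

lemma euler: "card vertices + card (faces L) = card (edges L) + 2"
  using lopsp by (simp add: lopsp_operation_def plane_map_def)

abbreviation marked :: "'d set set" where
  "marked \<equiv> {v0 L, v1 L, v2 L}"

lemma marked: "marked \<subseteq> vertices" "v0 L \<noteq> v1 L" "v0 L \<noteq> v2 L" "v1 L \<noteq> v2 L"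
  using lopsp by (auto simp: lopsp_operation_def)

abbreviation col :: "'d \<Rightarrow> nat" where
  "col d \<equiv> colour L (vertex_of L d)"

lemma col_opp: "d \<in> darts L \<Longrightarrow> col (opp L d) \<noteq> col d"
  using lopsp by (auto simp: lopsp_operation_def)

lemma col_cases: "d \<in> darts L \<Longrightarrow> col d \<in> {0, 1, 2}"
  using lopsp vertex_in unfolding lopsp_operation_def by (simp add: image_subset_iff)

lemma loopfree: "d \<in> darts L \<Longrightarrow> vertex_of L d \<noteq> vertex_of L (opp L d)"
  using col_opp by metis

lemma triangle:
  assumes "d \<in> darts L"
  shows "face_next L (face_next L (face_next L d)) = d"
proof -
  let ?f = "face_next L"
  let ?k = "funpow_dist1 ?f d d"
  have "card (orbit ?f d) = 3"
    using lopsp assms by (simp add: lopsp_operation_def faces_def)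
  moreover have "card (orbit ?f d) = ?k"
    using orbit_conv_funpow_dist1[OF mem_face] card_image[OF inj_on_funpow_dist1[OF mem_face]]
    by (metis card_atLeastLessThan diff_zero)
  ultimately have "(?f ^^ 3) d = d" using funpow_dist1_prop[OF mem_face] by metis
  then show ?thesis by (simp add: eval_nat_numeral)
qed

lemma vertex_face_next [simp]: "vertex_of L (face_next L d) = vertex_of L (opp L d)"
  by (simp add: face_next_def)

lemma vertex_opp_face_next2:
  assumes "d \<in> darts L"
  shows "vertex_of L (opp L (face_next L (face_next L d))) = vertex_of L d"
  using triangle[OF assms] vertex_face_next[of "face_next L (face_next L d)"] by simp

text \<open>The third side of the triangle between two consecutive edges at a vertex.\<close>

lemma link:
  assumes "d \<in> darts L"
  shows "face_next L (rot L d) \<in> darts L"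
    "vertex_of L (face_next L (rot L d)) = vertex_of L (opp L (rot L d))"
    "vertex_of L (opp L (face_next L (rot L d))) = vertex_of L (opp L d)"
  using assms vertex_opp_face_next2[of "opp L d"] by (simp_all add: face_next_in rot_in)

text \<open>If consecutive edges at a vertex were parallel, the third side of their triangle would
  be a loop.\<close>

lemma link_neq:
  assumes "d \<in> darts L"
  shows "vertex_of L (opp L (rot L d)) \<noteq> vertex_of L (opp L d)"
  using link[OF assms] loopfree by metis

lemma card_vertex:
  assumes "v \<in> vertices"
  shows "out_degree (graph L) v = card v"
proof -
  obtain d where d: "d \<in> darts L" "v = vertex_of L d" using assms by (auto simp: vertices_def)
  have "out_arcs (graph L) v = v"
    using d vertex_of_subset[OF d(1)] vertex_of_eq_iff by (auto simp: out_arcs_def)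
  then show ?thesis by (simp add: out_degree_def)
qed

lemma two_cycle_predecoration:
  assumes ab: "parallel a b" and col: "col a \<noteq> 1" "col (opp L a) \<noteq> 1"
  shows "two_cycle (predecoration L) (opp L) (edge_pair a b)"
proof -
  have ab': "a \<in> darts L" "b \<in> darts L" "a \<noteq> b" "vertex_of L a = vertex_of L b"
    "vertex_of L (opp L a) = vertex_of L (opp L b)" "vertex_of L a \<noteq> vertex_of L (opp L a)"
    using ab by (auto simp: parallel_def)
  have "col a \<in> {0, 2}" "col (opp L a) \<in> {0, 2}"
    using col col_cases[of a] col_cases[of "opp L a"] ab'(1) by auto
  then have "pre_digraph.cycle (predecoration L) [a, opp L b]"
    using ab' col unfolding pre_digraph.cycle_def pre_digraph.awalk_def
    by (auto simp: predecoration_def edge_has_colour_def pre_digraph.awalk_verts.simps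
        pre_digraph.cas.simps intro!: exI[of _ "vertex_of L a"])
  moreover have "opp L b \<noteq> opp L a" using ab'(3) by (metis opp_opp)
  moreover have "edge_pair a b = {a, opp L a, opp L b, opp L (opp L b)}"
    by (auto simp: edge_pair_def)
  ultimately show ?thesis unfolding two_cycle_def by blast
qed

lemma parallel_if_two_cycle_predecoration:
  assumes "two_cycle (predecoration L) (opp L) C"
  shows "\<exists>a b. parallel a b \<and> C = edge_pair a b"
proof -
  obtain a b where ab: "pre_digraph.cycle (predecoration L) [a, b]" "b \<noteq> opp L a"
      "C = {a, opp L a, b, opp L b}"
    using assms by (auto simp: two_cycle_def)
  have "parallel a (opp L b)"
  proof -
    have "a \<in> darts L" "b \<in> darts L" "vertex_of L (opp L a) = vertex_of L b"
      "vertex_of L (opp L b) = vertex_of L a"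
      using ab(1) unfolding pre_digraph.cycle_def pre_digraph.awalk_def
      by (auto simp: predecoration_def pre_digraph.cas.simps)
    then show ?thesis using ab(2) loopfree[of a] unfolding parallel_def by (metis opp_in_iff opp_opp)
  qed
  moreover have "C = edge_pair a (opp L b)" using ab(3) by (auto simp: edge_pair_def)
  ultimately show ?thesis by blast
qed

definition unmarked_side :: "'d set \<Rightarrow> 'd set \<Rightarrow> bool" where
  "unmarked_side C X \<longleftrightarrow> X \<in> sides L C \<and> \<not> (\<exists>v\<in>marked. on_side C X v)"

text \<open>Consecutive edges at a vertex are never parallel, so both angles between
  \<open>a\<close> and \<open>b\<close> contain a further dart. This excludes degree 2, the degree
  of a marked vertex of colour 1, and with degree 4 it places \<open>a\<close> and \<open>b\<close>
  opposite to each other.\<close>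

lemma degree_four_rotation:
  assumes ab: "parallel a b" and col: "col a = 1"
  shows "vertex_of L a \<notin> marked" "rot L (rot L b) = a"
proof -
  let ?x = "vertex_of L a"
  have ab': "a \<in> darts L" "b \<in> darts L" "a \<noteq> b" "?x = vertex_of L b"
    "vertex_of L (opp L a) = vertex_of L (opp L b)"
    using ab by (auto simp: parallel_def)
  have mem: "a \<in> ?x" "b \<in> ?x" "rot L a \<in> ?x" "rot L b \<in> ?x"  "rot L (rot L b) \<in> ?x"
    using ab'(4) vertex_of_eq_iff vertex_of_rot by metis+
  have inj: "rot L d = rot L e \<longleftrightarrow> d = e" for d e
    using permutes_inj[OF rot_permutes] by (metis injD)
  have rot_neq: "rot L d \<noteq> d" if "d \<in> darts L" for d using link_neq[OF that] by metis
  have ne: "rot L a \<noteq> a" "rot L a \<noteq> b" "rot L b \<noteq> a" "rot L b \<noteq> b" "rot L b \<noteq> rot L a"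
    using link_neq ab' rot_neq inj by metis+
  have fin: "finite ?x" using vertex_of_subset[OF ab'(1)] finite_darts finite_subset by blast
  show unm: "?x \<notin> marked"
  proof
    assume "?x \<in> marked"
    then have "card ?x = 2" 
      using lopsp col card_vertex[of ?x] ab'(1) by (auto simp: lopsp_operation_def)
    moreover have "card {a, b, rot L a} = 3" using ab' ne by auto
    moreover have "card {a, b, rot L a} \<le> card ?x" using mem fin by (intro card_mono) auto
    ultimately show False by simp
  qed
  then have "card ?x = 4"
    using lopsp col card_vertex[of ?x] ab'(1) by (auto simp: lopsp_operation_def)
  moreover have "card {a, b, rot L a, rot L b} = 4" using ab' ne by auto
  moreover have "{a, b, rot L a, rot L b} \<subseteq> ?x" using mem by auto
  ultimately have x: "?x = {a, b, rot L a, rot L b}" using fin card_subset_eq by metis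
  have "rot L (rot L b) \<noteq> b"
  proof
    assume eq: "rot L (rot L b) = b"
    have "vertex_of L b \<subseteq> {b, rot L b}"
      unfolding vertex_of_def by (rule orbit_closed_subset) (use eq in auto)
    then show False using mem(1) ab' ne by auto
  qed
  moreover have "rot L (rot L b) \<noteq> rot L b" "rot L (rot L b) \<noteq> rot L a"
    using inj ne by auto
  ultimately show "rot L (rot L b) = a" using mem(5) x by auto
qed

text \<open>The new side is \<open>X\<close> together with the two triangles \<open>T\<close> outside \<open>X\<close> at the vertex of colour 1.\<close>

lemma unmarked_side_grow:
  assumes ab: "parallel a b" and col: "col a = 1"
    and X: "unmarked_side (edge_pair a b) X" and in_X: "opp L a \<in> X" "b \<in> X"
  shows "\<exists>C X. two_cycle (predecoration L) (opp L) C \<and> unmarked_side C X"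
proof -
  let ?C = "edge_pair a b"
  have ab': "a \<in> darts L" "b \<in> darts L" "a \<noteq> b" "vertex_of L a = vertex_of L b"
    "vertex_of L (opp L a) = vertex_of L (opp L b)"
    using ab by (auto simp: parallel_def)
  note cl = sides_class[of X ?C]
  have side: "X \<in> sides L ?C" using X by (simp add: unmarked_side_def)
  \<comment> \<open>\<open>z\<close> is the dart between \<open>b\<close> and \<open>a\<close> in
    the angle away from \<open>X\<close>; \<open>g\<close> and \<open>h\<close> are the edges
    opposite to the vertex in the two triangles at \<open>z\<close>.\<close>
  define z where "z = rot L b"
  define g where "g = face_next L z"
  define h where "h = face_next L a"
  have z: "z \<in> darts L" "vertex_of L z = vertex_of L a" using ab' by (simp_all add: z_def rot_in)
  have rot_z: "rot L z = a" using degree_four_rotation[OF ab col] by (simp add: z_def)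
  have gh: "g \<in> darts L" "h \<in> darts L" using z ab' by (simp_all add: g_def h_def face_next_in)
  have next_g: "face_next L g = opp L b"
    using triangle[of "opp L b"] ab' by (simp add: g_def z_def)
  have next_h: "face_next L h = opp L z"
    using triangle[of "opp L z"] z rot_z by (simp add: h_def)
  define y where "y = vertex_of L (opp L a)"
  define w where "w = vertex_of L (opp L z)"
  have v_g: "vertex_of L g = w" "vertex_of L (opp L g) = y"
    using vertex_face_next[of z] vertex_face_next[of g] ab'(5) unfolding next_g
    by (simp_all add: g_def w_def y_def)
  have v_h: "vertex_of L h = y" "vertex_of L (opp L h) = w"
    using vertex_face_next[of a] vertex_face_next[of h] unfolding next_h
    by (simp_all add: h_def w_def y_def)
  define T where "T = {opp L b, z, g, opp L z, a, h}"
  define Y where "Y = X \<union> T"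
  have T_vertex: "vertex_of L d \<in> {vertex_of L a, y, w}" if "d \<in> T" for d
    using that v_g v_h z ab' by (auto simp: T_def y_def w_def)
  have Y_darts: "Y \<subseteq> darts L" using cl(1)[OF side] ab' z gh by (auto simp: Y_def T_def)
  have Y_face: "face_next L d \<in> Y" if "d \<in> Y" for d
    using that cl(3)[OF side] next_g next_h rot_z by (auto simp: Y_def T_def g_def z_def h_def)
  \<comment> \<open>The edges of \<open>a\<close>, \<open>b\<close> and \<open>z\<close> now have
    both sides in \<open>Y\<close>, so \<open>Y\<close> can only be left across \<open>g\<close> and
    \<open>h\<close>.\<close>
  have Y_opp: "opp L d \<in> Y" if "d \<in> Y" "d \<notin> {g, h}" for d
    using that cl(3)[OF side] in_X unfolding Y_def T_def edge_pair_def by auto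
  \<comment> \<open>A marked vertex within \<open>Y\<close> that avoids \<open>T\<close> would lie
    inside \<open>X\<close>. The vertices of the two triangles are \<open>y\<close>,
    \<open>w\<close> and the tail of \<open>a\<close>, which is unmarked.\<close>
  have marked_Y: "v \<in> {y, w}" if v: "v \<in> marked" "v \<subseteq> Y" for v
  proof -
    obtain d0 where d0: "v = vertex_of L d0" using v(1) marked(1) by (auto simp: vertices_def)
    have "\<not> on_side ?C X v" using X v(1) by (auto simp: unmarked_side_def)
    moreover have "on_side ?C X v" if disj: "v \<inter> T = {}"
    proof -
      have "d \<notin> v" if "d \<in> ?C" for d
      proof
        assume "d \<in> v"
        moreover have "\<exists>e\<in>T. vertex_of L e = vertex_of L d"
          using that ab' by (auto simp: edge_pair_def T_def)
        ultimately show False using disj d0 vertex_of_eq_iff by (metis disjoint_iff)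
      qed
      then show ?thesis using v(2) disj by (auto simp: on_side_def Y_def)
    qed
    ultimately obtain d where "d \<in> v" "d \<in> T" by blast
    then have "v \<in> {vertex_of L a, y, w}" using T_vertex d0 vertex_of_eq_iff by metis
    then show ?thesis using v(1) degree_four_rotation[OF ab col] by auto
  qed
  \<comment> \<open>If the two new edges coincided, \<open>Y\<close> would have no boundary and be
    the whole sphere, and the three marked vertices would all be \<open>y\<close> or
    \<open>w\<close>.\<close>
  have g_h: "g \<noteq> opp L h"
  proof
    assume eq: "g = opp L h"
    have "Y = darts L"
    proof (rule transitive_face[OF Y_darts])
      have "opp L g = h" "opp L h = g" using eq by simp_all
      moreover have "g \<in> Y" "h \<in> Y" by (simp_all add: Y_def T_def)
      ultimately show "opp L d \<in> Y" if "d \<in> Y" for d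
        using Y_opp[OF that] by (cases "d = g \<or> d = h") auto
      show "Y \<noteq> {}" using \<open>g \<in> Y\<close> by blast
    qed (rule Y_face)
    moreover have "v \<subseteq> darts L" if v: "v \<in> vertices" for v
      using v vertex_of_subset unfolding vertices_def by blast
    ultimately have in_Y: "v \<subseteq> Y" if "v \<in> marked" for v
      using subsetD[OF marked(1) that] by simp
    have "v0 L \<in> {y, w}" "v1 L \<in> {y, w}" "v2 L \<in> {y, w}"
      by (rule marked_Y; use in_Y in simp)+
    then show False using marked(2-4) by auto
  qed
  have par: "parallel g (opp L h)"
    using g_h gh v_g v_h loopfree[OF gh(1)] by (auto simp: parallel_def)
  let ?C' = "edge_pair g (opp L h)"
  have "col g \<noteq> 1" "col (opp L g) \<noteq> 1"
    using col_opp[OF z(1)] col_opp[OF ab'(1)] z(2) col v_g by (simp_all add: w_def y_def)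
  then have two: "two_cycle (predecoration L) (opp L) ?C'"
    by (rule two_cycle_predecoration[OF par])
  obtain X' where X': "X' \<in> sides L ?C'" "b \<in> X'" using side_exists ab'(2) by metis
  have "X' \<subseteq> Y"
  proof (rule side_subset[OF X'(1) edge_pair_symmetric Y_darts _ X'(2)])
    show "side_closed ?C' Y" using Y_face Y_opp by (auto simp: edge_pair_def)
    show "b \<in> Y" using in_X by (simp add: Y_def)
  qed
  have "\<not> on_side ?C' X' v" if v: "v \<in> marked" for v
  proof
    assume "on_side ?C' X' v"
    then have "v \<in> {y, w}" "v \<inter> ?C' = {}"
      using marked_Y[OF v] \<open>X' \<subseteq> Y\<close> by (auto simp: on_side_def)
    moreover have "g \<in> w" "h \<in> y" using v_g v_h mem_vertex_of by metis+
    ultimately show False by (auto simp: edge_pair_def)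
  qed
  then show ?thesis using two X'(1) unfolding unmarked_side_def by blast
qed

text \<open>By symmetry a vertex of colour 1 may be taken as the tail of \<open>a\<close>, with the
  side in the angle from \<open>a\<close> to \<open>b\<close>. Without such a vertex the 2-cycle
  already belongs to the predecoration.\<close>

lemma unmarked_side_predecoration:
  assumes ab: "parallel a b" and X: "unmarked_side (edge_pair a b) X"
  shows "\<exists>C X. two_cycle (predecoration L) (opp L) C \<and> unmarked_side C X"
proof -
  have grow: ?thesis if par: "parallel c d" and col: "col c = 1" and X: "unmarked_side (edge_pair c d) X"
    for c d
  proof -
    have "X \<in> sides L (edge_pair c d)" using X by (simp add: unmarked_side_def)
    then consider "opp L c \<in> X" "d \<in> X" | "opp L d \<in> X" "c \<in> X"
      using side_meets_edge_pair par by blast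
    then show ?thesis
    proof cases
      case 1
      then show ?thesis using unmarked_side_grow par col X by blast
    next
      case 2
      moreover have "parallel d c" using par by (rule parallel_sym)
      moreover have "col d = 1" using par col by (simp add: parallel_def)
      moreover have "unmarked_side (edge_pair d c) X" using X edge_pair_sym by metis
      ultimately show ?thesis using unmarked_side_grow by blast
    qed
  qed
  consider "col a = 1" | "col (opp L a) = 1" | "col a \<noteq> 1" "col (opp L a) \<noteq> 1" by blast
  then show ?thesis
  proof cases
    case 1
    then show ?thesis using grow ab X by blast
  next
    case 2
    then show ?thesis using grow[OF parallel_opp[OF ab]] X edge_pair_opp by simp
  next
    case 3
    then show ?thesis using two_cycle_predecoration[OF ab] X by blast
  qed
qed

section \<open>Cut-paths and 2-cycles in the map cut open\<close>

lemma cas_nth: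
  assumes "pre_digraph.cas G u p v" "Suc i < length p"
  shows "head G (p ! i) = tail G (p ! Suc i)"
  using assms
proof (induction p arbitrary: u i)
  case (Cons e p)
  show ?case
  proof (cases i)
    case 0
    then show ?thesis using Cons.prems by (cases p) (auto simp: pre_digraph.cas.simps)
  next
    case (Suc j)
    then show ?thesis using Cons.prems Cons.IH[of "head G e" j] by (auto simp: pre_digraph.cas.simps)
  qed
qed simp

lemma cut_pathD:
  assumes "cut_path L p"
  shows "cut_map L p" "length p \<ge> 2" "\<And>v. v \<in> marked \<Longrightarrow> \<exists>d\<in>path_darts L p. vertex_of L d = v"
proof -
  have path: "graph.apath (v1 L) p (v2 L)" and v0: "v0 L \<in> set (graph.awalk_verts (v1 L) p)"
    using assms by (auto simp: cut_path_def)
  have sub: "set p \<subseteq> darts L" and cas: "graph.cas (v1 L) p (v2 L)"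
    and dist: "distinct (graph.awalk_verts (v1 L) p)"
    using path by (auto simp: graph.apath_def graph.awalk_def)
  have ne: "p \<noteq> []" using cas marked(4) by auto
  have verts: "graph.awalk_verts (v1 L) p = map (vertex_of L) p @ [vertex_of L (opp L (last p))]"
  proof -
    have "tail (graph L) = vertex_of L" "head (graph L) = (\<lambda>d. vertex_of L (opp L d))"
      by (simp_all add: graph_def)
    then show ?thesis using ne by (simp add: graph.awalk_verts_conv)
  qed
  have dist': "distinct (map (vertex_of L) p)" "vertex_of L (opp L (last p)) \<notin> set (map (vertex_of L) p)"
    using dist verts by auto
  have ends: "v1 L = vertex_of L (hd p)" "v2 L = vertex_of L (opp L (last p))"
    using cas verts graph.awlast_of_awalk[of "v1 L" p "v2 L"] path ne
    by (auto simp: graph.apath_def graph.cas_simp)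
  show "cut_map L p"
  proof
    show "set p \<subseteq> darts L" "p \<noteq> []" by fact+
    show "vertex_of L (opp L (p ! i)) = vertex_of L (p ! Suc i)" if "Suc i < length p" for i
      using cas_nth[OF cas that] by simp
    show "i = j" if "i < length p" "j < length p" "vertex_of L (p ! i) = vertex_of L (p ! j)" for i j
      using that dist'(1) by (metis distinct_conv_nth length_map nth_map)
    show "vertex_of L (opp L (p ! (length p - 1))) \<noteq> vertex_of L (p ! i)" if "i < length p" for i
      using that dist'(2) ne by (auto simp: last_conv_nth)
  qed
  have v0': "v0 L \<in> set (map (vertex_of L) p @ [vertex_of L (opp L (last p))])"
    using v0 unfolding verts .
  show "\<exists>d\<in>path_darts L p. vertex_of L d = v" if "v \<in> marked" for v
  proof -
    have "v \<in> set (map (vertex_of L) p @ [vertex_of L (opp L (last p))])"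
      using that v0' ends ne by auto
    then show ?thesis using ne by (auto simp: path_darts_def)
  qed
  \<comment> \<open>A single edge has only the end vertices \<open>v1 L\<close> and
    \<open>v2 L\<close>, which leaves no place for \<open>v0 L\<close>.\<close>
  show "length p \<ge> 2"
  proof (rule ccontr)
    assume "\<not> length p \<ge> 2"
    then obtain d where "p = [d]" using ne by (cases p; cases "tl p") auto
    then show False using v0' ends marked(2,3) by auto
  qed
qed

text \<open>Every marked vertex is left by some path dart. If the vertex were inside
  \<open>X\<close>, this dart would be in \<open>P\<close> and in \<open>Y\<close>, hence on the
  2-cycle, a contradiction.\<close>

lemma two_cycle_cut_open:
  assumes p: "cut_path L p" and C: "two_cycle (graph (cut_open L p)) (opp (cut_open L p)) C"
  shows "\<exists>C X. two_cycle (predecoration L) (opp L) C \<and> unmarked_side C X"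
proof -
  interpret cut_map L p using cut_pathD(1)[OF p] .
  obtain a b Y where ab: "parallel a b" and Y: "Y \<subseteq> darts L" "Y \<inter> edge_pair a b \<noteq> {}"
    "\<And>d. d \<in> Y \<Longrightarrow> face_next L d \<in> Y" "\<And>d. d \<in> Y - edge_pair a b \<Longrightarrow> opp L d \<in> Y"
    "P \<inter> Y \<subseteq> edge_pair a b"
    using two_cycle_in_cut_map[OF euler loopfree cut_pathD(2)[OF p] C] by metis
  obtain d where d: "d \<in> Y" using Y(2) by blast
  obtain X where X: "X \<in> sides L (edge_pair a b)" "d \<in> X" using side_exists d Y(1) by blast
  have "X \<subseteq> Y"
    by (rule side_subset[OF X(1) edge_pair_symmetric Y(1) _ X(2) d]) (use Y in auto)
  have "\<not> on_side (edge_pair a b) X v" if "v \<in> marked" for v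
  proof
    assume on: "on_side (edge_pair a b) X v"
    obtain e where e: "e \<in> P" "vertex_of L e = v" using cut_pathD(3)[OF p \<open>v \<in> marked\<close>] by blast
    then have "e \<in> v" by auto
    then show False using on e \<open>X \<subseteq> Y\<close> Y(5) by (auto simp: on_side_def)
  qed
  then have "unmarked_side (edge_pair a b) X" using X(1) unfolding unmarked_side_def by blast
  then show ?thesis by (rule unmarked_side_predecoration[OF ab])
qed

end

section \<open>Existence and rerouting of cut-paths\<close>

text \<open>Paths are vertex lists here because the search for a cut-path depends on adjacency only;
  darts are chosen at the end.\<close>

definition simple_path :: "('v \<Rightarrow> 'v \<Rightarrow> bool) \<Rightarrow> 'v \<Rightarrow> 'v list \<Rightarrow> 'v \<Rightarrow> bool" where
  "simple_path E a xs b \<longleftrightarrow> xs \<noteq> [] \<and> hd xs = a \<and> last xs = b \<and> distinct xs \<and> successively E xs"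

lemma simple_path_mono:
  assumes "simple_path R a xs b" "\<And>u w. R u w \<Longrightarrow> E u w"
  shows "simple_path E a xs b"
proof -
  have "successively E xs"
    by (rule successively_mono[of R]) (use assms in \<open>auto simp: simple_path_def\<close>)
  then show ?thesis using assms(1) by (simp add: simple_path_def)
qed

lemma successively_prefix: "successively E (us @ z # vs) \<Longrightarrow> successively E (us @ [z])"
  by (auto simp: successively_append_iff)

lemma simple_path_prefix:
  assumes "simple_path E a (us @ z # vs) b"
  shows "simple_path E a (us @ [z]) z"
proof -
  have "successively E (us @ [z])"
    using assms by (intro successively_prefix[of E us z vs]) (simp add: simple_path_def)
  then show ?thesis using assms by (cases us) (simp_all add: simple_path_def)
qed

text \<open>When the next vertex already lies on the path, the path is truncated there.\<close>

lemma ex_simple_path: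
  assumes "R\<^sup>*\<^sup>* a b"
  shows "\<exists>xs. simple_path R a xs b"
  using assms
proof (induction rule: rtranclp_induct)
  case base
  then show ?case by (intro exI[of _ "[a]"]) (simp add: simple_path_def)
next
  case (step y z)
  then obtain xs where xs: "simple_path R a xs y" by blast
  show ?case
  proof (cases "z \<in> set xs")
    case True
    then obtain us vs where "xs = us @ z # vs" by (meson split_list)
    then have "simple_path R a (us @ [z]) z" using xs simple_path_prefix by metis
    then show ?thesis by blast
  next
    case False
    then have "simple_path R a (xs @ [z]) z"
      using xs step.hyps(2) by (auto simp: simple_path_def successively_append_iff)
    then show ?thesis by blast
  qed
qed

text \<open>The relation excludes \<open>x\<close> on every step; \<open>a \<noteq> x\<close> covers
  the path of one vertex, which has no step.\<close>

lemma simple_path_avoids: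
  assumes "simple_path (\<lambda>u w. E u w \<and> u \<noteq> x \<and> w \<noteq> x) a xs b" "a \<noteq> x"
  shows "x \<notin> set xs"
proof -
  have "successively (\<lambda>u w. E u w \<and> u \<noteq> x \<and> w \<noteq> x) xs \<Longrightarrow> xs \<noteq> [] \<Longrightarrow> hd xs \<noteq> x \<Longrightarrow> x \<notin> set xs"
    by (induction xs rule: induct_list012) auto
  then show ?thesis using assms by (auto simp: simple_path_def)
qed

text \<open>If \<open>z\<close> lies on the path between \<open>a\<close> and \<open>b\<close>, take a detour around \<open>z\<close>. The part
  of the path after \<open>z\<close> is adjacent to \<open>z\<close> at both of its ends, so from the point where the
  detour meets it one can choose the direction that reaches \<open>z\<close> through \<open>b\<close>.\<close>

lemma simple_path_through_extend:
  assumes sym: "\<And>u w. E u w \<Longrightarrow> E w u"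
    and detour: "\<And>x u w. u \<in> V \<Longrightarrow> w \<in> V \<Longrightarrow> u \<noteq> x \<Longrightarrow> w \<noteq> x \<Longrightarrow>
      (\<lambda>u w. E u w \<and> u \<noteq> x \<and> w \<noteq> x)\<^sup>*\<^sup>* u w"
    and V: "a \<in> V" "y \<in> V"
    and R: "simple_path E a R y" "b \<in> set R" and z: "E y z" "z \<noteq> a"
  shows "\<exists>xs. simple_path E a xs z \<and> b \<in> set xs"
proof (cases "z \<in> set R")
  case False
  then have "simple_path E a (R @ [z]) z"
    using R z by (auto simp: simple_path_def successively_append_iff)
  then show ?thesis using R(2) by (intro exI[of _ "R @ [z]"]) simp
next
  case True
  then obtain R1 R2 where R_eq: "R = R1 @ z # R2" by (meson split_list)
  show ?thesis
  proof (cases "b \<in> set (R1 @ [z])")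
    case True
    moreover have "simple_path E a (R1 @ [z]) z"
      using R(1) simple_path_prefix unfolding R_eq by metis
    ultimately show ?thesis by blast
  next
    case False
    then have b: "b \<in> set R2" using R(2) by (simp add: R_eq)
    then have ne: "R1 \<noteq> []" "R2 \<noteq> []" using R z(2) by (auto simp: R_eq simple_path_def)
    have dist: "distinct (R1 @ z # R2)" and succ: "successively E (R1 @ z # R2)"
      and a: "hd R1 = a" and y: "last R2 = y"
      using R(1) ne by (auto simp: R_eq simple_path_def)
    have aR1: "a \<in> set R1" and yR2: "y \<in> set R2" using ne a y by auto
    then have "y \<noteq> z" using dist by auto
    with z(2) have "(\<lambda>u w. E u w \<and> u \<noteq> z \<and> w \<noteq> z)\<^sup>*\<^sup>* a y"
      by (intro detour[OF V]) auto
    from ex_simple_path[OF this] obtain Z where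
      Z: "simple_path (\<lambda>u w. E u w \<and> u \<noteq> z \<and> w \<noteq> z) a Z y" ..
    have z_Z: "z \<notin> set Z" using simple_path_avoids[OF Z] z(2) by simp
    have Z': "simple_path E a Z y" by (rule simple_path_mono[OF Z]) simp
    have "\<exists>t\<in>set Z. t \<in> set R2" using Z' yR2 by (auto simp: simple_path_def)
    \<comment> \<open>\<open>t\<close> is the first vertex of the detour on \<open>R2\<close>, and
      \<open>s\<close> below is the last vertex before it on \<open>R1\<close>; so the bridge
      \<open>ws\<close> between them avoids both parts.\<close>
    then obtain Z1 t Z2 where t: "Z = Z1 @ t # Z2" "t \<in> set R2" "\<forall>v\<in>set Z1. v \<notin> set R2"
      using split_list_first_prop[of Z "\<lambda>t. t \<in> set R2"] by blast
    have "Z1 \<noteq> []" using Z' t aR1 dist by (auto simp: simple_path_def)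
    then have "\<exists>s\<in>set Z1. s \<in> set R1"
      using Z' t aR1 by (intro bexI[of _ "hd Z1"]) (auto simp: simple_path_def)
    then obtain Y1 s ws where s: "Z1 = Y1 @ s # ws" "s \<in> set R1" "\<forall>v\<in>set ws. v \<notin> set R1"
      using split_list_last_prop[of Z1 "\<lambda>s. s \<in> set R1"] by blast
    obtain A1 A2 where R1: "R1 = A1 @ s # A2" using s(2) by (meson split_list)
    obtain B1 B2 where R2: "R2 = B1 @ t # B2" using t(2) by (meson split_list)
    have "Z = Y1 @ (s # ws @ [t]) @ Z2" using s(1) t(1) by simp
    then have bridge: "successively E (s # ws @ [t])" "distinct (s # ws @ [t])"
      using Z' by (simp_all only: simple_path_def successively_append_iff distinct_append)
    have "set ws \<subseteq> set Z1" "set ws \<subseteq> set Z" using s(1) t(1) by auto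
    then have ws: "set ws \<inter> (set R1 \<union> set R2 \<union> {z}) = {}" using s(3) t(3) z_Z by blast
    have start: "successively E (A1 @ [s])"
      using succ successively_prefix[of E A1 s "A2 @ z # R2"] by (simp add: R1)
    have hd_start: "hd (A1 @ [s]) = a" using a by (cases A1) (simp_all add: R1)
    have join: "successively E (A1 @ s # ws @ t # us)" if "successively E (t # us)" for us
    proof -
      have "successively E ((s # ws) @ t # us)"
        using bridge(1) that successively_append_iff[of E "s # ws" "[t]"]
          successively_append_iff[of E "s # ws" "t # us"] by simp
      then show ?thesis
        using start successively_append_iff[of E A1 "[s]"] successively_append_iff[of E A1 "s # ws @ t # us"]
        by simp
    qed
    have finish: "simple_path E a (A1 @ s # ws @ t # us @ [z]) z"
      if "successively E (t # us @ [z])" "set us \<subseteq> set R2 - {t}" "distinct us" for us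
      unfolding simple_path_def
    proof (intro conjI)
      show "successively E (A1 @ s # ws @ t # us @ [z])" by (rule join[OF that(1)])
      show "hd (A1 @ s # ws @ t # us @ [z]) = a" using hd_start by (cases A1) simp_all
      show "distinct (A1 @ s # ws @ t # us @ [z])"
        using dist bridge(2) ws that(2,3) t(2) by (auto simp: R1)
    qed auto
    \<comment> \<open>\<open>B1\<close> leads from \<open>z\<close> to \<open>t\<close>. If
      \<open>b\<close> is on it, go back from \<open>t\<close> to \<open>z\<close>; otherwise go on
      along \<open>B2\<close> to \<open>y\<close> and take the edge from \<open>y\<close> to
      \<open>z\<close>.\<close>
    show ?thesis
    proof (cases "b \<in> set B1")
      case False
      have "successively E (t # B2)"
        using succ successively_append_iff[of E "R1 @ z # B1" "t # B2"] by (simp add: R2)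
      moreover have "last (t # B2) = y" using y by (simp add: R2)
      ultimately have "successively E (t # B2 @ [z])"
        using z(1) successively_append_iff[of E "t # B2" "[z]"] by simp
      then have "simple_path E a (A1 @ s # ws @ t # B2 @ [z]) z"
        by (rule finish) (use dist in \<open>auto simp: R2\<close>)
      then show ?thesis using False b by (intro exI[of _ "A1 @ s # ws @ t # B2 @ [z]"]) (auto simp: R2)
    next
      case True
      have "successively E (z # B1 @ [t])"
        using succ successively_append_iff[of E R1 "z # B1 @ t # B2"]
          successively_prefix[of E "z # B1" t B2] by (simp add: R2)
      then have "successively (\<lambda>u w. E w u) (z # B1 @ [t])"
        by (rule successively_mono) (rule sym)
      then have "successively E (rev (z # B1 @ [t]))" by (simp only: successively_rev)
      then have "simple_path E a (A1 @ s # ws @ t # rev B1 @ [z]) z"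
        by (intro finish) (use dist in \<open>auto simp: R2\<close>)
      then show ?thesis using True by (intro exI[of _ "A1 @ s # ws @ t # rev B1 @ [z]"]) auto
    qed
  qed
qed

text \<open>A path from \<open>a\<close> to \<open>b\<close> exists. Its end is then moved step by
  step along a walk from \<open>b\<close> to \<open>c\<close>, with \<open>b\<close> kept on the
  path; the walk avoids \<open>a\<close>, as each extension requires.\<close>

lemma ex_simple_path_through:
  assumes sym: "\<And>u w. E u w \<Longrightarrow> E w u"
    and E_V: "\<And>u w. E u w \<Longrightarrow> w \<in> V"
    and detour: "\<And>x u w. u \<in> V \<Longrightarrow> w \<in> V \<Longrightarrow> u \<noteq> x \<Longrightarrow> w \<noteq> x \<Longrightarrow>
      (\<lambda>u w. E u w \<and> u \<noteq> x \<and> w \<noteq> x)\<^sup>*\<^sup>* u w"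
    and V: "a \<in> V" "b \<in> V" "c \<in> V" and neq: "a \<noteq> b" "a \<noteq> c" "b \<noteq> c"
  shows "\<exists>xs. simple_path E a xs c \<and> b \<in> set xs"
proof -
  have "(\<lambda>u w. E u w \<and> u \<noteq> a \<and> w \<noteq> a)\<^sup>*\<^sup>* b c"
    using neq by (intro detour[OF V(2,3)]) auto
  then have "c \<in> V \<and> (\<exists>xs. simple_path E a xs c \<and> b \<in> set xs)"
  proof (induction rule: rtranclp_induct)
    case base
    have "(\<lambda>u w. E u w \<and> u \<noteq> c \<and> w \<noteq> c)\<^sup>*\<^sup>* a b"
      using neq by (intro detour[OF V(1,2)]) auto
    from ex_simple_path[OF this] obtain xs where
      "simple_path (\<lambda>u w. E u w \<and> u \<noteq> c \<and> w \<noteq> c) a xs b" ..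
    then have xs: "simple_path E a xs b" by (rule simple_path_mono) simp
    then have "b \<in> set xs" by (auto simp: simple_path_def)
    then show ?case using xs V(2) by blast
  next
    case (step y z)
    then obtain xs where "simple_path E a xs y" "b \<in> set xs" by blast
    then have "\<exists>xs. simple_path E a xs z \<and> b \<in> set xs"
      using simple_path_through_extend[of E V a y xs b z] sym detour V(1) step by blast
    then show ?case using E_V step.hyps(2) by blast
  qed
  then show ?thesis ..
qed

section \<open>2-connectedness of the triangulation and existence of a cut-path\<close>

context lopsp
begin

definition adjacent :: "'d set \<Rightarrow> 'd set \<Rightarrow> bool" where
  "adjacent u w \<longleftrightarrow> (\<exists>d\<in>darts L. vertex_of L d = u \<and> vertex_of L (opp L d) = w)"

lemma adjacent_sym: "adjacent u w \<Longrightarrow> adjacent w u"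
  unfolding adjacent_def by (metis opp_in_iff opp_opp)

text \<open>The neighbours of \<open>x\<close> are connected by the third sides of the triangles at \<open>x\<close>.\<close>

lemma adjacent_detour:
  assumes "u \<in> vertices" "w \<in> vertices" "u \<noteq> x" "w \<noteq> x"
  shows "(\<lambda>u w. adjacent u w \<and> u \<noteq> x \<and> w \<noteq> x)\<^sup>*\<^sup>* u w"
proof -
  let ?R = "\<lambda>u w. adjacent u w \<and> u \<noteq> x \<and> w \<noteq> x"
  \<comment> \<open>Each dart is assigned an end of its edge different from \<open>x\<close>. Under
    \<open>opp\<close> and \<open>rot\<close> this end stays or moves to a neighbour, so
    transitivity on darts yields connectedness without \<open>x\<close>.\<close>
  define other where "other d = (if vertex_of L d = x then vertex_of L (opp L d) else vertex_of L d)" for d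
  define S where "S = {d \<in> darts L. ?R\<^sup>*\<^sup>* u (other d)}"
  have other_neq: "other d \<noteq> x" if "d \<in> darts L" for d
    using loopfree[OF that] by (auto simp: other_def)
  have S_step: "e \<in> S" if "d \<in> S" "e \<in> darts L" "other d = other e \<or> adjacent (other d) (other e)" for d e
    using that other_neq by (auto simp: S_def intro: rtranclp.rtrancl_into_rtrancl)
  obtain d where d: "d \<in> darts L" "u = vertex_of L d" using assms by (auto simp: vertices_def)
  obtain e where e: "e \<in> darts L" "w = vertex_of L e" using assms by (auto simp: vertices_def)
  have "S = darts L"
  proof (rule transitive)
    show "S \<subseteq> darts L" by (auto simp: S_def)
    have "d \<in> S" using d assms by (simp add: S_def other_def)
    then show "S \<noteq> {}" by blast
  next
    fix f assume f: "f \<in> S"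
    then have fD: "f \<in> darts L" by (simp add: S_def)
    have "adjacent (vertex_of L f) (vertex_of L (opp L f))" using fD by (auto simp: adjacent_def)
    then have "other f = other (opp L f) \<or> adjacent (other f) (other (opp L f))"
      using loopfree[OF fD] by (auto simp: other_def)
    then show "opp L f \<in> S" using S_step[OF f] fD by simp
    have "adjacent (vertex_of L (opp L (rot L f))) (vertex_of L (opp L f))"
      using link[OF fD] unfolding adjacent_def by blast
    then have "adjacent (vertex_of L (opp L f)) (vertex_of L (opp L (rot L f)))"
      by (rule adjacent_sym)
    then have "other f = other (rot L f) \<or> adjacent (other f) (other (rot L f))"
      by (auto simp: other_def)
    then show "rot L f \<in> S" using S_step[OF f] fD by (simp add: rot_in)
  qed
  then have "?R\<^sup>*\<^sup>* u (other e)" using e by (auto simp: S_def)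
  then show ?thesis using e assms by (simp add: other_def)
qed

lemma awalk_last: "graph.awalk u p v \<Longrightarrow> last (graph.awalk_verts u p) = v"
  and awalk_hd: "graph.awalk u p v \<Longrightarrow> hd (graph.awalk_verts u p) = u"
  by simp_all

lemma awalk_if_successively_adjacent:
  assumes "successively adjacent (u # us)" "u \<in> vertices"
  shows "\<exists>p. graph.awalk u p (last (u # us)) \<and> graph.awalk_verts u p = u # us"
  using assms
proof (induction us arbitrary: u)
  case Nil
  then show ?case by (intro exI[of _ "[]"]) (simp add: graph.awalk_Nil_iff)
next
  case (Cons w us)
  then obtain d where d: "d \<in> darts L" "vertex_of L d = u" "vertex_of L (opp L d) = w"
    by (auto simp: adjacent_def)
  then have "w \<in> vertices" by auto
  then obtain p where "graph.awalk w p (last (w # us))" "graph.awalk_verts w p = w # us"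
    using Cons by auto
  then show ?case using d by (intro exI[of _ "d # p"]) (auto simp: graph.awalk_Cons_iff)
qed

lemma ex_cut_path: "\<exists>p. cut_path L p"
proof -
  have "\<exists>xs. simple_path adjacent (v1 L) xs (v2 L) \<and> v0 L \<in> set xs"
  proof (rule ex_simple_path_through[where V = vertices])
    show "w \<in> vertices" if "adjacent u w" for u w using that by (auto simp: adjacent_def)
  qed (use adjacent_sym adjacent_detour marked in auto)
  then obtain xs where xs: "simple_path adjacent (v1 L) xs (v2 L)" "v0 L \<in> set xs" by blast
  then obtain us where us: "xs = v1 L # us" by (cases xs) (auto simp: simple_path_def)
  obtain p where "graph.awalk (v1 L) p (v2 L)" "graph.awalk_verts (v1 L) p = xs"
    using awalk_if_successively_adjacent[of "v1 L" us] xs(1) marked(1) us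
    by (auto simp: simple_path_def)
  then have "cut_path L p" using xs by (simp add: cut_path_def graph.apath_def simple_path_def)
  then show ?thesis ..
qed

section \<open>Rerouting a cut-path out of an unmarked side\<close>

context
  fixes a b X
  assumes ab: "parallel a b" and side: "X \<in> sides L (edge_pair a b)"
    and unmarked: "\<And>v. v \<in> marked \<Longrightarrow> \<not> on_side (edge_pair a b) X v"
begin

abbreviation (input) "C \<equiv> edge_pair a b"
abbreviation (input) "ends \<equiv> {vertex_of L a, vertex_of L (opp L a)}"
abbreviation (input) "inside \<equiv> on_side (edge_pair a b) X"

lemma vertex_edge_pair:
  assumes "d \<in> C"
  shows "vertex_of L d \<in> ends"
proof -
  have "vertex_of L b = vertex_of L a" "vertex_of L (opp L b) = vertex_of L (opp L a)"
    using ab by (simp_all add: parallel_def)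
  then show ?thesis using assms unfolding edge_pair_def by fastforce
qed

lemma opp_inner:
  assumes "d \<in> X - C"
  shows "opp L d \<in> X - C"
proof -
  have "opp L d \<in> X" using sides_class(3)[OF side] assms by blast
  moreover have "opp L d \<notin> C"
    using assms edge_pair_symmetric[of a b] by (metis DiffD2 image_subset_iff opp_opp)
  ultimately show ?thesis by simp
qed

text \<open>Turning around the vertex stays in \<open>X\<close> as long as no dart of the 2-cycle is
  met, and such darts occur only at its two ends.\<close>

lemma inner_vertex:
  assumes d: "d \<in> X - C"
  shows "vertex_of L d \<in> ends \<or> inside (vertex_of L d)"
proof (cases "vertex_of L d \<in> ends")
  case False
  have disj: "vertex_of L d \<inter> C = {}"
    using False vertex_edge_pair vertex_of_eq by fastforce
  have "vertex_of L d \<subseteq> {e \<in> X - C. e \<in> vertex_of L d}"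
    unfolding vertex_of_def[of L d]
  proof (rule orbit_closed_subset)
    fix e assume "e \<in> {e \<in> X - C. e \<in> orbit (rot L) d}"
    then have e: "e \<in> X - C" "e \<in> vertex_of L d" by (auto simp: vertex_of_def)
    then have "rot L e \<in> X"
      using opp_inner[OF e(1)] sides_class(3)[OF side] face_next_opp by (metis DiffD1)
    moreover have "rot L e \<in> vertex_of L d" using e(2) unfolding vertex_of_def by (rule orbit.step)
    ultimately show "rot L e \<in> {e \<in> X - C. e \<in> orbit (rot L) d}"
      using disj by (auto simp: vertex_of_def)
  qed (use d mem_vertex_of in \<open>auto simp: vertex_of_def\<close>)
  then show ?thesis using disj by (auto simp: on_side_def)
qed simp

lemma inner_if_inside: "inside (vertex_of L d) \<Longrightarrow> d \<in> X - C"
  using mem_vertex_of[of d] unfolding on_side_def by blast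

text \<open>Edges at a vertex inside the side lead to vertices inside or to ends of the 2-cycle, so
  the walk has to leave through an end; \<open>t\<close> is the first one.\<close>

lemma inner_walk_prefix:
  assumes "graph.awalk u q w" "u \<in> ends \<or> inside u" "\<not> inside w"
  shows "\<exists>q1 q2 t. q = q1 @ q2 \<and> t \<in> ends \<and> graph.awalk u q1 t \<and> graph.awalk t q2 w \<and>
    (\<forall>v\<in>set (graph.awalk_verts u q1). v = t \<or> inside v)"
  using assms
proof (induction q arbitrary: u)
  case Nil
  then show ?case
    by (intro exI[of _ "[]"] exI[of _ w]) (auto simp: graph.awalk_Nil_iff)
next
  case (Cons d q)
  have d: "d \<in> darts L" "u = vertex_of L d" "graph.awalk (vertex_of L (opp L d)) q w"
    using Cons.prems(1) by (auto simp: graph.awalk_Cons_iff)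
  show ?case
  proof (cases "u \<in> ends")
    case True
    moreover have "graph.awalk u [] u" using d by (simp add: graph.awalk_Nil_iff)
    ultimately show ?thesis
      using Cons.prems(1) by (intro exI[of _ "[]"] exI[of _ "d # q"] exI[of _ u]) auto
  next
    case False
    then have u: "inside u" using Cons.prems(2) by simp
    then have "opp L d \<in> X - C" using inner_if_inside opp_inner d(2) by blast
    then have "vertex_of L (opp L d) \<in> ends \<or> inside (vertex_of L (opp L d))" by (rule inner_vertex)
    then obtain q1 q2 t where q: "q = q1 @ q2" "t \<in> ends" "graph.awalk (vertex_of L (opp L d)) q1 t"
        "graph.awalk t q2 w" "\<forall>v\<in>set (graph.awalk_verts (vertex_of L (opp L d)) q1). v = t \<or> inside v"
      using Cons.IH[OF d(3) _ Cons.prems(3)] by blast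
    have "graph.awalk u (d # q1) t" using d q(3) by (simp add: graph.awalk_Cons_iff)
    then show ?thesis
      using q u d(2) by (intro exI[of _ "d # q1"] exI[of _ q2] exI[of _ t]) auto
  qed
qed

text \<open>The mirror image of \<open>inner_walk_prefix\<close>: \<open>s\<close> is the last end
  of the 2-cycle on the walk.\<close>

lemma inner_walk_suffix:
  assumes "graph.awalk w q u" "u \<in> ends \<or> inside u" "\<not> inside w"
  shows "\<exists>q1 q2 s. q = q1 @ q2 \<and> s \<in> ends \<and> graph.awalk w q1 s \<and> graph.awalk s q2 u \<and>
    (\<forall>v\<in>set (graph.awalk_verts s q2). v = s \<or> inside v)"
  using assms
proof (induction q arbitrary: u rule: rev_induct)
  case Nil
  then show ?case
    by (intro exI[of _ "[]"] exI[of _ w]) (auto simp: graph.awalk_Nil_iff)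
next
  case (snoc d q)
  have d: "d \<in> darts L" "u = vertex_of L (opp L d)" "graph.awalk w q (vertex_of L d)"
    using snoc.prems(1) by (auto simp: graph.awalk_Cons_iff graph.awalk_Nil_iff)
  show ?case
  proof (cases "u \<in> ends")
    case True
    moreover have "graph.awalk u [] u" using d by (simp add: graph.awalk_Nil_iff)
    ultimately show ?thesis
      using snoc.prems(1) by (intro exI[of _ "q @ [d]"] exI[of _ "[]"] exI[of _ u]) auto
  next
    case False
    then have u: "inside u" using snoc.prems(2) by simp
    then have "opp L (opp L d) \<in> X - C" using inner_if_inside opp_inner d(2) by blast
    then have "vertex_of L d \<in> ends \<or> inside (vertex_of L d)" using inner_vertex by simp
    then obtain q1 q2 s where q: "q = q1 @ q2" "s \<in> ends" "graph.awalk w q1 s"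
        "graph.awalk s q2 (vertex_of L d)" "\<forall>v\<in>set (graph.awalk_verts s q2). v = s \<or> inside v"
      using snoc.IH[OF d(3) _ snoc.prems(3)] by blast
    have walk: "graph.awalk s (q2 @ [d]) u"
      using d q(4) by (auto simp: graph.awalk_Cons_iff graph.awalk_Nil_iff intro!: graph.awalk_appendI)
    have "set (graph.awalk_verts s (q2 @ [d])) \<subseteq> insert u (set (graph.awalk_verts s q2))"
      using d(2) graph.awalk_verts_append[OF walk] by auto
    then show ?thesis
      using q walk u by (intro exI[of _ q1] exI[of _ "q2 @ [d]"] exI[of _ s]) auto
  qed
qed

text \<open>As \<open>v1 L\<close> and \<open>v2 L\<close> are not inside the side, the path meets
  ends \<open>s\<close> and \<open>t\<close> of the 2-cycle before and after \<open>d\<close>. The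
  piece \<open>r\<close> between them is replaced by one edge of the 2-cycle.\<close>

lemma cut_path_shortcut:
  assumes p: "cut_path L p" and d: "d \<in> set p" "d \<in> X - C"
  shows "\<exists>q. cut_path L q \<and> length q \<le> length p \<and>
    length (filter (\<lambda>d. d \<in> X - C) q) < length (filter (\<lambda>d. d \<in> X - C) p)"
proof -
  have walk: "graph.awalk (v1 L) p (v2 L)" and dist: "distinct (graph.awalk_verts (v1 L) p)"
    and v0: "v0 L \<in> set (graph.awalk_verts (v1 L) p)"
    using p by (auto simp: cut_path_def graph.apath_def)
  obtain p1 p2 where p_eq: "p = p1 @ d # p2" using d(1) by (meson split_list)
  have walks: "graph.awalk (v1 L) p1 (vertex_of L d)" "graph.awalk (vertex_of L (opp L d)) p2 (v2 L)"
      and dD: "d \<in> darts L"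
    using walk by (auto simp: p_eq graph.awalk_Cons_iff)
  obtain q1 r1 s where 1: "p1 = q1 @ r1" "s \<in> ends" "graph.awalk (v1 L) q1 s"
      "graph.awalk s r1 (vertex_of L d)" "\<forall>v\<in>set (graph.awalk_verts s r1). v = s \<or> inside v"
    using inner_walk_suffix[OF walks(1) inner_vertex[OF d(2)] unmarked] by blast
  obtain r2 q3 t where 2: "p2 = r2 @ q3" "t \<in> ends" "graph.awalk (vertex_of L (opp L d)) r2 t"
      "graph.awalk t q3 (v2 L)" "\<forall>v\<in>set (graph.awalk_verts (vertex_of L (opp L d)) r2). v = t \<or> inside v"
    using inner_walk_prefix[OF walks(2) inner_vertex[OF opp_inner[OF d(2)]] unmarked] by blast
  define r where "r = r1 @ d # r2"
  have r: "graph.awalk s r t"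
    unfolding r_def using 1(4) 2(3) dD by (intro graph.awalk_appendI[OF 1(4)]) (simp add: graph.awalk_Cons_iff)
  have r_verts: "v \<in> {s, t} \<or> inside v" if "v \<in> set (graph.awalk_verts s r)" for v
  proof -
    have "graph.awalk (vertex_of L d) (d # r2) t" using 2(3) dD by (simp add: graph.awalk_Cons_iff)
    then have "set (graph.awalk_verts s r) =
        set (graph.awalk_verts s r1) \<union> set (graph.awalk_verts (vertex_of L d) (d # r2))"
      unfolding r_def by (rule graph.set_awalk_verts_append[OF 1(4)])
    moreover have "vertex_of L d \<in> set (graph.awalk_verts s r1)"
      using awalk_last[OF 1(4)] by (metis graph.awalk_verts_non_Nil last_in_set)
    ultimately have "v \<in> set (graph.awalk_verts s r1) \<or>
        v \<in> set (graph.awalk_verts (vertex_of L (opp L d)) r2)"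
      using that by auto
    then show ?thesis using 1(5) 2(5) by blast
  qed
  have p_q: "p = q1 @ (r @ q3)" by (simp add: p_eq 1(1) 2(1) r_def)
  have tail: "graph.awalk s (r @ q3) (v2 L)" using r 2(4) by (rule graph.awalk_appendI)
  have verts: "graph.awalk_verts (v1 L) p =
      graph.awalk_verts (v1 L) q1 @ tl (graph.awalk_verts s r) @ tl (graph.awalk_verts t q3)"
    using graph.awalk_verts_append[OF walk[unfolded p_q]] graph.awalk_verts_append[OF tail]
    unfolding p_q awalk_last[OF 1(3)] awalk_last[OF r]
    by (simp only: tl_append2[OF graph.awalk_verts_non_Nil])
  have t_in: "t \<in> set (tl (graph.awalk_verts s r))"
    using awalk_last[OF r] by (cases r) (auto simp: r_def split: if_splits)
  have s_in: "s \<in> set (graph.awalk_verts (v1 L) q1)"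
    using awalk_last[OF 1(3)] by (metis graph.awalk_verts_non_Nil last_in_set)
  \<comment> \<open>The path visits no vertex twice, so \<open>s\<close> and \<open>t\<close> are
    the two different ends and the edge of \<open>a\<close> joins them.\<close>
  have "s \<noteq> t" using dist s_in t_in by (auto simp: verts)
  then have "\<exists>e\<in>{a, opp L a}. vertex_of L e = s \<and> vertex_of L (opp L e) = t"
    using 1(2) 2(2) by auto
  then obtain e where e: "e \<in> {a, opp L a}" "vertex_of L e = s" "vertex_of L (opp L e) = t" by blast
  have eD: "e \<in> darts L" using e(1) ab by (auto simp: parallel_def)
  have eC: "e \<in> C" using e(1) by (auto simp: edge_pair_def)
  define q where "q = q1 @ e # q3"
  have q_walk: "graph.awalk (v1 L) q (v2 L)"
    unfolding q_def using 2(4) e eD by (intro graph.awalk_appendI[OF 1(3)]) (simp add: graph.awalk_Cons_iff)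
  have "graph.awalk_verts t q3 = t # tl (graph.awalk_verts t q3)"
    using awalk_hd[OF 2(4)] by (metis graph.awalk_verts_non_Nil list.collapse)
  then have q_verts: "graph.awalk_verts (v1 L) q =
      graph.awalk_verts (v1 L) q1 @ t # tl (graph.awalk_verts t q3)"
    using graph.awalk_verts_append[of "v1 L" q1 "e # q3" "v2 L"] q_walk e(3)
      awalk_last[OF 1(3)] by (simp add: q_def)
  have "distinct (graph.awalk_verts (v1 L) q)"
    using dist t_in unfolding verts q_verts by auto
  moreover have "v0 L \<in> set (graph.awalk_verts (v1 L) q)"
  proof -
    \<comment> \<open>The other vertices of the removed piece are inside the side, hence
      unmarked.\<close>
    have "v0 L \<in> {s, t}" if "v0 L \<in> set (tl (graph.awalk_verts s r))"
    proof -
      have "v0 L \<in> set (graph.awalk_verts s r)"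
        using that by (rule list.set_sel(2)[OF graph.awalk_verts_non_Nil])
      then show ?thesis using r_verts[of "v0 L"] unmarked[of "v0 L"] by simp
    qed
    then show ?thesis using v0 s_in unfolding verts q_verts by auto
  qed
  ultimately have "cut_path L q" using q_walk by (simp add: cut_path_def graph.apath_def)
  moreover have "length q \<le> length p" by (simp add: q_def p_q r_def)
  \<comment> \<open>The removed piece contains \<open>d\<close>, which is counted; the new dart
    \<open>e\<close> is on the 2-cycle and is not.\<close>
  moreover have "length (filter (\<lambda>d. d \<in> X - C) q) < length (filter (\<lambda>d. d \<in> X - C) p)"
    using d(2) eC by (simp add: q_def p_q r_def)
  ultimately show ?thesis by blast
qed

lemma ex_minimal_cut_path_off_side:
  "\<exists>p. minimal_cut_path L p \<and> path_darts L p \<inter> X \<subseteq> C"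
proof -
  let ?bad = "\<lambda>p. length (filter (\<lambda>d. d \<in> X - C) p)"
  obtain p0 where "minimal_cut_path L p0"
    using ex_cut_path ex_has_least_nat[of "cut_path L" _ length] by (auto simp: minimal_cut_path_def)
  then obtain p where p: "minimal_cut_path L p" "\<And>q. minimal_cut_path L q \<Longrightarrow> ?bad p \<le> ?bad q"
    using ex_has_least_nat[of "minimal_cut_path L" p0 ?bad] by blast
  have p0: "cut_path L p" using p(1) by (simp add: minimal_cut_path_def)
  have no_bad: "d \<notin> X - C" if "d \<in> set p" for d
  proof
    assume "d \<in> X - C"
    from cut_path_shortcut[OF p0 that this] obtain q where
      q: "cut_path L q" "length q \<le> length p" "?bad q < ?bad p"
      by (elim exE conjE)
    then have "minimal_cut_path L q" using p(1) unfolding minimal_cut_path_def by (meson le_trans)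
    then show False using p(2) q(3) by (meson not_less)
  qed
  have "path_darts L p \<inter> X \<subseteq> C"
  proof
    fix d assume d: "d \<in> path_darts L p \<inter> X"
    show "d \<in> C"
    proof (rule ccontr)
      assume "d \<notin> C"
      then have "d \<in> X - C" "opp L d \<in> X - C" using d opp_inner by blast+
      then show False using no_bad d by (auto simp: path_darts_def)
    qed
  qed
  then show ?thesis using p(1) by blast
qed

lemma not_c2: "\<not> c2 L"
proof -
  obtain p where p: "minimal_cut_path L p" and off: "path_darts L p \<inter> X \<subseteq> C"
    using ex_minimal_cut_path_off_side by blast
  interpret cut_map L p
    using cut_pathD(1) p by (simp add: minimal_cut_path_def)
  have lift: "\<exists>D. two_cycle (graph K) (opp K) D"
    if "parallel c d" "edge_pair c d = C" "opp L c \<in> X" for c d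
    using sides_class[OF side] off that by (intro two_cycle_lift[OF that(1), of X]) auto
  \<comment> \<open>Which angle the side fills decides whether \<open>a\<close> or \<open>b\<close>
    comes first in the lifting.\<close>
  have "opp L a \<in> X \<or> opp L b \<in> X" using side_meets_edge_pair[OF side ab] by blast
  then have "\<exists>D. two_cycle (graph K) (opp K) D"
    using lift[OF ab] lift[OF parallel_sym[OF ab] edge_pair_sym] by blast
  then show ?thesis using p by (auto simp: c2_def)
qed

end

lemma c2_iff_no_unmarked_side:
  "c2 L \<longleftrightarrow> \<not> (\<exists>C X. two_cycle (predecoration L) (opp L) C \<and> unmarked_side C X)"
proof -
  have "\<exists>C X. two_cycle (predecoration L) (opp L) C \<and> unmarked_side C X" if not_c2: "\<not> c2 L"
  proof -
    from not_c2 obtain p C where p: "minimal_cut_path L p"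
      and C: "two_cycle (graph (cut_open L p)) (opp (cut_open L p)) C"
      unfolding c2_def not_all not_imp not_not by (elim exE conjE)
    from p have "cut_path L p" by (simp add: minimal_cut_path_def)
    then show ?thesis using C by (rule two_cycle_cut_open)
  qed
  moreover have "\<not> c2 L" if C: "two_cycle (predecoration L) (opp L) C" and X: "unmarked_side C X" for C X
  proof -
    obtain a b where ab: "parallel a b" "C = edge_pair a b"
      using parallel_if_two_cycle_predecoration[OF C] by blast
    show ?thesis
    proof (rule not_c2[OF ab(1)])
      show "X \<in> sides L (edge_pair a b)" using X ab(2) by (simp add: unmarked_side_def)
      show "\<not> on_side (edge_pair a b) X v" if "v \<in> marked" for v
        using X that ab(2) unfolding unmarked_side_def by blast
    qed
  qed
  ultimately show ?thesis by blast
qed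

end

theorem theorem9:
  fixes L :: "'d lopsp"
  assumes "lopsp_operation L"
  shows "c2 L \<longleftrightarrow>
    (\<forall>C. two_cycle (predecoration L) (opp L) C \<longrightarrow>
       (\<forall>X \<in> sides L C. \<exists>v \<in> {v0 L, v1 L, v2 L}. on_side C X v))"
proof -
  have "lopsp L" using assms by (rule lopsp.intro)
  then show ?thesis
    using lopsp.c2_iff_no_unmarked_side[of L] lopsp.unmarked_side_def[of L] by blast
qed

end
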